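(* Let $(A,\mu,[-,-]_A)$ be a Poisson algebra over $R$, let $\phi:A\to A$ be a Poisson algebra automorphism, and let $(A,\mu,\{-,-\},\phi)$ be the purely hom-Poisson algebra obtained by composition, i.e. $\{x,y\}=\phi([x,y]_A)$. Let $D_A^\phi$ be the $A$-module of formal $\phi$-differentials of $(A,\phi)$. Then $(A,D_A^\phi,[-,-],\phi,\tilde{\alpha_\phi},\rho_\phi)$ is a hom-Lie-Rinehart algebra over $(A,\phi)$, where (1) the endomorphism $\tilde{\alpha_\phi}:D_A^\phi\to D_A^\phi$ is given by $\tilde{\alpha_\phi}(a\,dx)=\phi(a)\,d(\phi(x))$; (2) the anchor map $\rho_\phi:D_A^\phi\to Der_\phi(A)$ is given by $\rho_\phi=\pi^*\circ\tilde{\alpha_\phi}$, where $\pi^*:D_A^\phi\to Der_\phi(A)$ is the $A$-linear map with $\pi^*(dx)(a)=\{x,a\}$; (3) the ($R$-bilinear) bracket is given by $$[a\,dx,b\,dy]=\phi(a)\phi(b)\,d\{x,y\}+\rho_\phi(a\,dx)(b)\,\tilde{\alpha_\phi}(dy)-\rho_\phi(b\,dy)(a)\,\tilde{\alpha_\phi}(dx);$$ for all $a,b,x,y\in A$.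
   Context: $R$ is a commutative ring with unity; all algebras and linear maps are over $R$. A Poisson algebra $(A,\mu,[-,-]_A)$ is a commutative associative $R$-algebra with an $R$-Lie bracket that is a derivation in each argument. $Der_\phi(A)$ is the $A$-module of $\phi$-derivations: $R$-linear maps $\delta:A\to A$ with $\delta(ab)=\phi(a)\delta(b)+\phi(b)\delta(a)$. $D_A^\phi$ is the $A$-module generated by symbols $da$ ($a\in A$) subject to $d(\lambda a+\mu b)=\lambda\,da+\mu\,db$ and $d(ab)=\phi(a)\,db+\phi(b)\,da$ for $a,b\in A$, $\lambda,\mu\in R$. A hom-Lie algebra $(\mathfrak{g},[-,-],\alpha)$ is an $R$-module with a skew-symmetric $R$-bilinear bracket and a linear map $\alpha$ with $\alpha[x,y]=[\alpha(x),\alpha(y)]$ and $[\alpha(x),[y,z]]+[\alpha(y),[z,x]]+[\alpha(z),[x,y]]=0$. A representation of it on an $R$-module $V$ is a pair $(\theta,\beta)$ of linear maps $\theta:\mathfrak{g}\to\mathrm{End}_R(V)$, $\beta:V\to V$ with $\theta(\alpha(x))\circ\beta=\beta\circ\theta(x)$ and $\theta([x,y])\circ\beta=\theta(\alpha(x))\circ\theta(y)-\theta(\alpha(y))\circ\theta(x)$. A purely hom-Poisson algebra $(A,\mu,\{-,-\},\alpha)$ is one where $(A,\{-,-\},\alpha)$ is a hom-Lie algebra, $(A,\mu)$ is associative commutative, and $\{x,\mu(y,z)\}=\mu(\alpha(y),\{x,z\})+\mu(\alpha(z),\{x,y\})$. A hom-Lie-Rinehart algebra over $(A,\phi)$ is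 a tuple $(A,L,[-,-],\phi,\alpha,\rho)$ with $L$ an $A$-module, $[-,-]:L\times L\to L$ skew-symmetric $R$-bilinear, $\phi:A\to A$ an algebra homomorphism, $\alpha:L\to L$ linear with $\alpha[x,y]=[\alpha(x),\alpha(y)]$, and $\rho:L\to Der_\phi(A)$ $R$-linear, such that for all $a\in A$, $x,y\in L$: (1) $(L,[-,-],\alpha)$ is a hom-Lie algebra; (2) $\alpha(a.x)=\phi(a).\alpha(x)$; (3) $(\rho,\phi)$ is a representation of $(L,[-,-],\alpha)$ on $A$; (4) $\rho(a.x)=\phi(a).\rho(x)$; (5) $[x,a.y]=\phi(a)[x,y]+\rho(x)(a)\alpha(y)$. *)

theory Defs
  imports HOL.Hull "HOL-Algebra.Module" "HOL-Algebra.AbelCoset"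
begin

section \<open>Modules\<close>

text \<open>
  The \<open>module\<close> record of the library extends the \<open>ring\<close> record, but the \<open>module\<close> locale
  ignores the fields \<open>mult\<close> and \<open>one\<close>; they are left undefined below.
\<close>

definition mk_module ::
  "'m set \<Rightarrow> 'm \<Rightarrow> ('m \<Rightarrow> 'm \<Rightarrow> 'm) \<Rightarrow> ('s \<Rightarrow> 'm \<Rightarrow> 'm) \<Rightarrow> ('s, 'm) module"
  where "mk_module C z p s =
    \<lparr>carrier = C, mult = undefined, one = undefined, zero = z, add = p, smult = s\<rparr>"

definition regular_module :: "('a, 'n) ring_scheme \<Rightarrow> ('a, 'a) module"
  where "regular_module A = mk_module (carrier A) \<zero>\<^bsub>A\<^esub> (add A) (mult A)"

definition restrict_scalars ::
  "('r, 'a, 'n) module_scheme \<Rightarrow> ('a, 'l, 'k) module_scheme \<Rightarrow> ('r, 'l) module"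
  where "restrict_scalars A L =
    mk_module (carrier L) \<zero>\<^bsub>L\<^esub> (add L) (\<lambda>r x. (r \<odot>\<^bsub>A\<^esub> \<one>\<^bsub>A\<^esub>) \<odot>\<^bsub>L\<^esub> x)"

text \<open>
  A module whose elements are functions from \<open>X\<close> to \<open>N\<close>, with pointwise operations. Its elements
  are extensional functions (\<open>undefined\<close> outside \<open>X\<close>), so that equality of elements is equality
  on \<open>X\<close>.
\<close>

definition pointwise_module ::
  "('x \<Rightarrow> 'm) set \<Rightarrow> 'x set \<Rightarrow> ('s, 'm, 'k) module_scheme \<Rightarrow> ('s, 'x \<Rightarrow> 'm) module"
  where "pointwise_module C X N =
    mk_module (C \<inter> extensional X) (\<lambda>x\<in>X. \<zero>\<^bsub>N\<^esub>)
      (\<lambda>f g. \<lambda>x\<in>X. f x \<oplus>\<^bsub>N\<^esub> g x) (\<lambda>s f. \<lambda>x\<in>X. s \<odot>\<^bsub>N\<^esub> f x)"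

definition linear_map ::
  "('s, 'p) ring_scheme \<Rightarrow> ('s, 'm, 'i) module_scheme \<Rightarrow> ('s, 'n, 'j) module_scheme \<Rightarrow> ('m \<Rightarrow> 'n) \<Rightarrow> bool"
  where "linear_map S M N f \<longleftrightarrow>
    f \<in> carrier M \<rightarrow> carrier N \<and>
    (\<forall>x\<in>carrier M. \<forall>y\<in>carrier M. f (x \<oplus>\<^bsub>M\<^esub> y) = f x \<oplus>\<^bsub>N\<^esub> f y) \<and>
    (\<forall>s\<in>carrier S. \<forall>x\<in>carrier M. f (s \<odot>\<^bsub>M\<^esub> x) = s \<odot>\<^bsub>N\<^esub> f x)"

definition bilinear_map ::
  "('s, 'p) ring_scheme \<Rightarrow> ('s, 'l, 'i) module_scheme \<Rightarrow> ('s, 'm, 'j) module_scheme \<Rightarrow>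
    ('s, 'n, 'k) module_scheme \<Rightarrow> ('l \<Rightarrow> 'm \<Rightarrow> 'n) \<Rightarrow> bool"
  where "bilinear_map S L M N b \<longleftrightarrow>
    (\<forall>x\<in>carrier L. linear_map S M N (b x)) \<and>
    (\<forall>y\<in>carrier M. linear_map S L N (\<lambda>x. b x y))"

definition End_module :: "('s, 'p) ring_scheme \<Rightarrow> ('s, 'm, 'i) module_scheme \<Rightarrow> ('s, 'm \<Rightarrow> 'm) module"
  where "End_module S M = pointwise_module {f. linear_map S M M f} (carrier M) M"

definition free_module :: "('a, 'n) ring_scheme \<Rightarrow> 'x set \<Rightarrow> ('a, 'x \<Rightarrow> 'a) module"
  where "free_module A X =
    pointwise_module {f. f \<in> X \<rightarrow> carrier A \<and> finite {x \<in> X. f x \<noteq> \<zero>\<^bsub>A\<^esub>}} X (regular_module A)"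

definition free_gen :: "('a, 'n) ring_scheme \<Rightarrow> 'x set \<Rightarrow> 'x \<Rightarrow> 'x \<Rightarrow> 'a"
  where "free_gen A X x = (\<lambda>y\<in>X. if y = x then \<one>\<^bsub>A\<^esub> else \<zero>\<^bsub>A\<^esub>)"

text \<open>
  The scalar multiplication on cosets follows the pattern of \<open>rcoset_mult\<close>: for a submodule
  \<open>N\<close> all the cosets in the union coincide.
\<close>

definition quotient_module ::
  "('a, 'm, 'i) module_scheme \<Rightarrow> 'm set \<Rightarrow> ('a, 'm set) module"
  where "quotient_module M N =
    mk_module (a_rcosets\<^bsub>M\<^esub> N) N (set_add M) (\<lambda>a X. \<Union>x\<in>X. N +>\<^bsub>M\<^esub> (a \<odot>\<^bsub>M\<^esub> x))"


section \<open>Poisson, hom-Lie and hom-Poisson algebras\<close>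

text \<open>
  The library locale \<open>algebra R A\<close> makes \<open>A\<close> an associative commutative unital \<open>R\<close>-algebra over
  a commutative unital ring \<open>R\<close>. Skew-symmetry is \<open>[x, y] = - [y, x]\<close> throughout.
\<close>

locale poisson_algebra = algebra R A
  for R :: "('r, 'p) ring_scheme" and A :: "('r, 'a, 'n) module_scheme" +
  fixes P :: "'a \<Rightarrow> 'a \<Rightarrow> 'a"
  assumes bracket_bilinear: "bilinear_map R A A A P"
    and bracket_skew: "\<lbrakk>x \<in> carrier A; y \<in> carrier A\<rbrakk> \<Longrightarrow> P x y = \<ominus>\<^bsub>A\<^esub> P y x"
    and bracket_jacobi:
      "\<lbrakk>x \<in> carrier A; y \<in> carrier A; z \<in> carrier A\<rbrakk> \<Longrightarrow>
        P x (P y z) \<oplus>\<^bsub>A\<^esub> P y (P z x) \<oplus>\<^bsub>A\<^esub> P z (P x y) = \<zero>\<^bsub>A\<^esub>"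
    and bracket_derivation_right:
      "\<lbrakk>x \<in> carrier A; y \<in> carrier A; z \<in> carrier A\<rbrakk> \<Longrightarrow>
        P x (y \<otimes>\<^bsub>A\<^esub> z) = y \<otimes>\<^bsub>A\<^esub> P x z \<oplus>\<^bsub>A\<^esub> z \<otimes>\<^bsub>A\<^esub> P x y"
    and bracket_derivation_left:
      "\<lbrakk>x \<in> carrier A; y \<in> carrier A; z \<in> carrier A\<rbrakk> \<Longrightarrow>
        P (x \<otimes>\<^bsub>A\<^esub> y) z = x \<otimes>\<^bsub>A\<^esub> P y z \<oplus>\<^bsub>A\<^esub> y \<otimes>\<^bsub>A\<^esub> P x z"

definition algebra_endomorphism ::
  "('r, 'p) ring_scheme \<Rightarrow> ('r, 'a, 'n) module_scheme \<Rightarrow> ('a \<Rightarrow> 'a) \<Rightarrow> bool"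
  where "algebra_endomorphism R A \<phi> \<longleftrightarrow> \<phi> \<in> ring_hom A A \<and> linear_map R A A \<phi>"

definition poisson_automorphism ::
  "('r, 'p) ring_scheme \<Rightarrow> ('r, 'a, 'n) module_scheme \<Rightarrow> ('a \<Rightarrow> 'a \<Rightarrow> 'a) \<Rightarrow> ('a \<Rightarrow> 'a) \<Rightarrow> bool"
  where "poisson_automorphism R A P \<phi> \<longleftrightarrow>
    algebra_endomorphism R A \<phi> \<and> bij_betw \<phi> (carrier A) (carrier A) \<and>
    (\<forall>x\<in>carrier A. \<forall>y\<in>carrier A. \<phi> (P x y) = P (\<phi> x) (\<phi> y))"

locale hom_lie_algebra = module R G
  for R :: "('r, 'p) ring_scheme" and G :: "('r, 'g, 'i) module_scheme" +
  fixes br :: "'g \<Rightarrow> 'g \<Rightarrow> 'g" and \<alpha> :: "'g \<Rightarrow> 'g"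
  assumes br_bilinear: "bilinear_map R G G G br"
    and br_skew: "\<lbrakk>x \<in> carrier G; y \<in> carrier G\<rbrakk> \<Longrightarrow> br x y = \<ominus>\<^bsub>G\<^esub> br y x"
    and twist_linear: "linear_map R G G \<alpha>"
    and twist_br: "\<lbrakk>x \<in> carrier G; y \<in> carrier G\<rbrakk> \<Longrightarrow> \<alpha> (br x y) = br (\<alpha> x) (\<alpha> y)"
    and hom_jacobi:
      "\<lbrakk>x \<in> carrier G; y \<in> carrier G; z \<in> carrier G\<rbrakk> \<Longrightarrow>
        br (\<alpha> x) (br y z) \<oplus>\<^bsub>G\<^esub> br (\<alpha> y) (br z x) \<oplus>\<^bsub>G\<^esub> br (\<alpha> z) (br x y) = \<zero>\<^bsub>G\<^esub>"

locale hom_lie_representation = hom_lie_algebra R G br \<alpha> + V: module R V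
  for R :: "('r, 'p) ring_scheme" and G :: "('r, 'g, 'i) module_scheme"
    and br :: "'g \<Rightarrow> 'g \<Rightarrow> 'g" and \<alpha> :: "'g \<Rightarrow> 'g"
    and V :: "('r, 'v, 'j) module_scheme" +
  fixes \<theta> :: "'g \<Rightarrow> 'v \<Rightarrow> 'v" and \<beta> :: "'v \<Rightarrow> 'v"
  assumes rep_linear: "linear_map R G (End_module R V) \<theta>"
    and rep_twist_linear: "linear_map R V V \<beta>"
    and rep_twist:
      "\<lbrakk>x \<in> carrier G; v \<in> carrier V\<rbrakk> \<Longrightarrow> \<theta> (\<alpha> x) (\<beta> v) = \<beta> (\<theta> x v)"
    and rep_br:
      "\<lbrakk>x \<in> carrier G; y \<in> carrier G; v \<in> carrier V\<rbrakk> \<Longrightarrow>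
        \<theta> (br x y) (\<beta> v) = \<theta> (\<alpha> x) (\<theta> y v) \<ominus>\<^bsub>V\<^esub> \<theta> (\<alpha> y) (\<theta> x v)"

locale purely_hom_poisson_algebra = algebra R A + hom_lie_algebra R A H \<alpha>
  for R :: "('r, 'p) ring_scheme" and A :: "('r, 'a, 'n) module_scheme"
    and H :: "'a \<Rightarrow> 'a \<Rightarrow> 'a" and \<alpha> :: "'a \<Rightarrow> 'a" +
  assumes hom_leibniz:
    "\<lbrakk>x \<in> carrier A; y \<in> carrier A; z \<in> carrier A\<rbrakk> \<Longrightarrow>
      H x (y \<otimes>\<^bsub>A\<^esub> z) = \<alpha> y \<otimes>\<^bsub>A\<^esub> H x z \<oplus>\<^bsub>A\<^esub> \<alpha> z \<otimes>\<^bsub>A\<^esub> H x y"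


section \<open>Hom-Lie-Rinehart algebras\<close>

definition Der_module ::
  "('r, 'p) ring_scheme \<Rightarrow> ('r, 'a, 'n) module_scheme \<Rightarrow> ('a \<Rightarrow> 'a) \<Rightarrow> ('a, 'a \<Rightarrow> 'a) module"
  where "Der_module R A \<phi> =
    pointwise_module
      {\<delta>. linear_map R A A \<delta> \<and>
        (\<forall>a\<in>carrier A. \<forall>b\<in>carrier A. \<delta> (a \<otimes>\<^bsub>A\<^esub> b) = \<phi> a \<otimes>\<^bsub>A\<^esub> \<delta> b \<oplus>\<^bsub>A\<^esub> \<phi> b \<otimes>\<^bsub>A\<^esub> \<delta> a)}
      (carrier A) (regular_module A)"

locale hom_lie_rinehart_algebra = algebra R A + L: module A L
  for R :: "('r, 'p) ring_scheme" and A :: "('r, 'a, 'n) module_scheme"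
    and L :: "('a, 'l, 'k) module_scheme" +
  fixes br :: "'l \<Rightarrow> 'l \<Rightarrow> 'l" and \<phi> :: "'a \<Rightarrow> 'a" and \<alpha> :: "'l \<Rightarrow> 'l"
    and \<rho> :: "'l \<Rightarrow> 'a \<Rightarrow> 'a"
  assumes phi_endomorphism: "algebra_endomorphism R A \<phi>"
    and anchor_linear:
      "linear_map R (restrict_scalars A L) (restrict_scalars A (Der_module R A \<phi>)) \<rho>"
    and hom_lie: "hom_lie_algebra R (restrict_scalars A L) br \<alpha>"
    and twist_smult:
      "\<lbrakk>a \<in> carrier A; x \<in> carrier L\<rbrakk> \<Longrightarrow> \<alpha> (a \<odot>\<^bsub>L\<^esub> x) = \<phi> a \<odot>\<^bsub>L\<^esub> \<alpha> x"
    and anchor_representation: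
      "hom_lie_representation R (restrict_scalars A L) br \<alpha> A \<rho> \<phi>"
    and anchor_smult:
      "\<lbrakk>a \<in> carrier A; x \<in> carrier L\<rbrakk> \<Longrightarrow> \<rho> (a \<odot>\<^bsub>L\<^esub> x) = \<phi> a \<odot>\<^bsub>Der_module R A \<phi>\<^esub> \<rho> x"
    and br_smult:
      "\<lbrakk>a \<in> carrier A; x \<in> carrier L; y \<in> carrier L\<rbrakk> \<Longrightarrow>
        br x (a \<odot>\<^bsub>L\<^esub> y) = \<phi> a \<odot>\<^bsub>L\<^esub> br x y \<oplus>\<^bsub>L\<^esub> \<rho> x a \<odot>\<^bsub>L\<^esub> \<alpha> y"


section \<open>Formal differentials twisted by an endomorphism\<close>

definition differential_relations ::
  "('r, 'p) ring_scheme \<Rightarrow> ('r, 'a, 'n) module_scheme \<Rightarrow> ('a \<Rightarrow> 'a) \<Rightarrow> ('a \<Rightarrow> 'a) set"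
  where "differential_relations R A \<phi> =
    (let F = free_module A (carrier A); RF = restrict_scalars A F; e = free_gen A (carrier A) in
      {e ((l \<odot>\<^bsub>A\<^esub> a) \<oplus>\<^bsub>A\<^esub> (m \<odot>\<^bsub>A\<^esub> b)) \<ominus>\<^bsub>F\<^esub> ((l \<odot>\<^bsub>RF\<^esub> e a) \<oplus>\<^bsub>F\<^esub> (m \<odot>\<^bsub>RF\<^esub> e b)) | l m a b.
        l \<in> carrier R \<and> m \<in> carrier R \<and> a \<in> carrier A \<and> b \<in> carrier A} \<union>
      {e (a \<otimes>\<^bsub>A\<^esub> b) \<ominus>\<^bsub>F\<^esub> ((\<phi> a \<odot>\<^bsub>F\<^esub> e b) \<oplus>\<^bsub>F\<^esub> (\<phi> b \<odot>\<^bsub>F\<^esub> e a)) | a b.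
        a \<in> carrier A \<and> b \<in> carrier A})"

definition differential_submodule ::
  "('r, 'p) ring_scheme \<Rightarrow> ('r, 'a, 'n) module_scheme \<Rightarrow> ('a \<Rightarrow> 'a) \<Rightarrow> ('a \<Rightarrow> 'a) set"
  where "differential_submodule R A \<phi> =
    (\<lambda>N. submodule N A (free_module A (carrier A))) hull differential_relations R A \<phi>"

definition differentials ::
  "('r, 'p) ring_scheme \<Rightarrow> ('r, 'a, 'n) module_scheme \<Rightarrow> ('a \<Rightarrow> 'a) \<Rightarrow> ('a, ('a \<Rightarrow> 'a) set) module"
  where "differentials R A \<phi> =
    quotient_module (free_module A (carrier A)) (differential_submodule R A \<phi>)"

definition diff ::
  "('r, 'p) ring_scheme \<Rightarrow> ('r, 'a, 'n) module_scheme \<Rightarrow> ('a \<Rightarrow> 'a) \<Rightarrow> 'a \<Rightarrow> ('a \<Rightarrow> 'a) set"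
  where "diff R A \<phi> x =
    differential_submodule R A \<phi> +>\<^bsub>free_module A (carrier A)\<^esub> free_gen A (carrier A) x"

text \<open>
  The elements \<open>a dx\<close> span the differentials additively (\<open>A\<close> is unital), so at most one triple of
  maps, considered on the carriers, satisfies the following conditions on \<open>\<alpha>\<close>, \<open>\<pi>\<close> (written
  \<open>\<pi>\<^sup>*\<close> in the literature) and \<open>br\<close>. That such maps exist is not assumed here.
\<close>

definition is_alpha_tilde ::
  "('r, 'p) ring_scheme \<Rightarrow> ('r, 'a, 'n) module_scheme \<Rightarrow> ('a \<Rightarrow> 'a) \<Rightarrow>
    (('a \<Rightarrow> 'a) set \<Rightarrow> ('a \<Rightarrow> 'a) set) \<Rightarrow> bool"
  where "is_alpha_tilde R A \<phi> \<alpha> \<longleftrightarrow>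
    (let D = differentials R A \<phi>; d = diff R A \<phi> in
      linear_map R (restrict_scalars A D) (restrict_scalars A D) \<alpha> \<and>
      (\<forall>a\<in>carrier A. \<forall>x\<in>carrier A. \<alpha> (a \<odot>\<^bsub>D\<^esub> d x) = \<phi> a \<odot>\<^bsub>D\<^esub> d (\<phi> x)))"

definition is_pi_star ::
  "('r, 'p) ring_scheme \<Rightarrow> ('r, 'a, 'n) module_scheme \<Rightarrow> ('a \<Rightarrow> 'a \<Rightarrow> 'a) \<Rightarrow> ('a \<Rightarrow> 'a) \<Rightarrow>
    (('a \<Rightarrow> 'a) set \<Rightarrow> 'a \<Rightarrow> 'a) \<Rightarrow> bool"
  where "is_pi_star R A H \<phi> \<pi> \<longleftrightarrow>
    linear_map A (differentials R A \<phi>) (Der_module R A \<phi>) \<pi> \<and>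
    (\<forall>x\<in>carrier A. \<forall>a\<in>carrier A. \<pi> (diff R A \<phi> x) a = H x a)"

definition is_differential_bracket ::
  "('r, 'p) ring_scheme \<Rightarrow> ('r, 'a, 'n) module_scheme \<Rightarrow> ('a \<Rightarrow> 'a \<Rightarrow> 'a) \<Rightarrow> ('a \<Rightarrow> 'a) \<Rightarrow>
    (('a \<Rightarrow> 'a) set \<Rightarrow> ('a \<Rightarrow> 'a) set) \<Rightarrow> (('a \<Rightarrow> 'a) set \<Rightarrow> 'a \<Rightarrow> 'a) \<Rightarrow>
    (('a \<Rightarrow> 'a) set \<Rightarrow> ('a \<Rightarrow> 'a) set \<Rightarrow> ('a \<Rightarrow> 'a) set) \<Rightarrow> bool"
  where "is_differential_bracket R A H \<phi> \<alpha> \<rho> br \<longleftrightarrow>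
    (let D = differentials R A \<phi>; RD = restrict_scalars A D; d = diff R A \<phi> in
      bilinear_map R RD RD RD br \<and>
      (\<forall>a\<in>carrier A. \<forall>b\<in>carrier A. \<forall>x\<in>carrier A. \<forall>y\<in>carrier A.
        br (a \<odot>\<^bsub>D\<^esub> d x) (b \<odot>\<^bsub>D\<^esub> d y) =
          (((\<phi> a \<otimes>\<^bsub>A\<^esub> \<phi> b) \<odot>\<^bsub>D\<^esub> d (H x y))
            \<oplus>\<^bsub>D\<^esub> (\<rho> (a \<odot>\<^bsub>D\<^esub> d x) b \<odot>\<^bsub>D\<^esub> \<alpha> (d y)))
            \<ominus>\<^bsub>D\<^esub> (\<rho> (b \<odot>\<^bsub>D\<^esub> d y) a \<odot>\<^bsub>D\<^esub> \<alpha> (d x))))"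

end

theory Submission
  imports Defs
begin

text \<open>
  The differentials have the universal property that an additive map \<open>G\<close> on them with prescribed
  values \<open>G (a dx) = g a x\<close> exists as soon as \<open>g\<close> respects the defining relations. No linearity
  over \<open>A\<close> is required, so this yields not only \<open>\<alpha>\<close> and \<open>\<pi>\<close> but also, applied to one argument after
  the other, the bracket. The axioms are then checked on the additive generators \<open>a dx\<close>. For the
  hom-Jacobi identity the jacobiator satisfies \<open>J u v (c w) = \<phi> (\<phi> c) (J u v w)\<close>, a consequence of
  the Leibniz rule of the bracket and of the representation property of the anchor; hence it
  suffices to have \<open>J (dx) (dy) (dz) = 0\<close>, which is \<open>d\<close> of the hom-Jacobi identity of \<open>A\<close>.
\<close>

text \<open>Apart from \<pi>, the maps in question are in general not \<open>A\<close>-linear: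
  \<alpha> and the anchor are \<phi>-semilinear, and \<open>br u\<close> adds an anchor term to the
  factor \<phi>(c) when c is pulled out. The usual \<open>A\<close>-linear universal property
  therefore does not produce them. A merely additive map has the drawback that its kernel need not
  be a submodule; prescribing it on all a dx, not just on dx, repairs this, since the relations can
  then be tested after multiplication by an arbitrary scalar.

  The anchor has to be \<phi>-semilinear while \<pi> is \<open>A\<close>-linear, and composing with
  \<alpha> supplies the missing \<phi>: on generators \<rho>(a dx)(b) = \<phi>(a) {\<phi>(x), b}.

  Existence and axioms are kept apart. The axioms are derived for any maps that satisfy the three
  characterising predicates, never from the formulas of the construction, because the last clause of
  the theorem quantifies over all such maps.\<close>

section \<open>Modules of functions and quotient modules\<close>

lemma mk_module_simps [simp]:
  "carrier (mk_module C z p s) = C" "zero (mk_module C z p s) = z"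
  "add (mk_module C z p s) = p" "smult (mk_module C z p s) = s"
  by (simp_all add: mk_module_def)

text \<open>A common criterion for the free module and for the module of \<phi>-derivations: closure
  of \<open>C\<close> under the pointwise operations suffices.\<close>

lemma module_pointwise_module:
  assumes "module S N" and sub: "C \<subseteq> X \<rightarrow> carrier N"
    and zero: "(\<lambda>x\<in>X. \<zero>\<^bsub>N\<^esub>) \<in> C"
    and add: "\<And>f g. f \<in> C \<Longrightarrow> g \<in> C \<Longrightarrow> (\<lambda>x\<in>X. f x \<oplus>\<^bsub>N\<^esub> g x) \<in> C"
    and smult: "\<And>s f. s \<in> carrier S \<Longrightarrow> f \<in> C \<Longrightarrow> (\<lambda>x\<in>X. s \<odot>\<^bsub>N\<^esub> f x) \<in> C"
  shows "module S (pointwise_module C X N)"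
proof -
  interpret module S N by fact
  have mem: "f x \<in> carrier N" if "f \<in> C" "x \<in> X" for f x using sub that by auto
  show ?thesis
  proof (rule moduleI)
    show "abelian_group (pointwise_module C X N)"
    proof (rule abelian_groupI, simp_all add: pointwise_module_def, goal_cases)
      case 6
      fix f assume f: "f \<in> C \<and> f \<in> extensional X"
      show "\<exists>g\<in>C \<inter> extensional X. (\<lambda>x\<in>X. g x \<oplus>\<^bsub>N\<^esub> f x) = (\<lambda>x\<in>X. \<zero>\<^bsub>N\<^esub>)"
      proof (rule bexI)
        \<comment> \<open>Closure under negation is not among the assumptions; the inverse is the
          multiple by -1.\<close>
        show "(\<lambda>x\<in>X. (\<ominus>\<^bsub>S\<^esub> \<one>\<^bsub>S\<^esub>) \<odot>\<^bsub>N\<^esub> f x) \<in> C \<inter> extensional X" using f smult by auto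
      qed (use f mem in \<open>auto simp: smult_l_minus M.l_neg intro!: restrict_ext\<close>)
    next
      case 5
      then show ?case by (auto simp: fun_eq_iff mem extensional_def restrict_def)
    qed (auto simp: add zero mem a_ac intro!: restrict_ext)
  qed (auto simp: pointwise_module_def smult smult [unfolded restrict_def] mem smult_l_distr smult_r_distr smult_assoc1
      extensional_def fun_eq_iff restrict_def intro: R.is_cring)
qed

lemma module_regular_module:
  assumes "cring A" shows "module A (regular_module A)"
proof -
  interpret cring A by fact
  show ?thesis
    by (rule moduleI, fact, rule abelian_groupI)
      (auto simp: regular_module_def a_ac m_assoc l_distr r_distr intro: l_neg)
qed

lemma module_free_module:
  assumes "cring A" shows "module A (free_module A X)"
proof -
  interpret cring A by fact
  show ?thesis
    unfolding free_module_def
  proof (rule module_pointwise_module[OF module_regular_module[OF assms]])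
    fix f g
    assume f: "f \<in> {f. f \<in> X \<rightarrow> carrier A \<and> finite {x \<in> X. f x \<noteq> \<zero>\<^bsub>A\<^esub>}}"
    show "(\<lambda>x\<in>X. s \<odot>\<^bsub>regular_module A\<^esub> f x) \<in> {f. f \<in> X \<rightarrow> carrier A \<and> finite {x \<in> X. f x \<noteq> \<zero>\<^bsub>A\<^esub>}}"
      if "s \<in> carrier A" for s
    proof -
      have "finite {x \<in> X. s \<otimes>\<^bsub>A\<^esub> f x \<noteq> \<zero>\<^bsub>A\<^esub>}"
        by (rule finite_subset[of _ "{x \<in> X. f x \<noteq> \<zero>\<^bsub>A\<^esub>}"]) (use f that in auto)
      then show ?thesis using f that by (auto simp: regular_module_def cong: conj_cong)
    qed
    assume g: "g \<in> {f. f \<in> X \<rightarrow> carrier A \<and> finite {x \<in> X. f x \<noteq> \<zero>\<^bsub>A\<^esub>}}"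
    have "finite ({x \<in> X. f x \<noteq> \<zero>\<^bsub>A\<^esub>} \<union> {x \<in> X. g x \<noteq> \<zero>\<^bsub>A\<^esub>})" using f g by simp
    then have "finite {x \<in> X. f x \<oplus>\<^bsub>A\<^esub> g x \<noteq> \<zero>\<^bsub>A\<^esub>}"
      by (rule rev_finite_subset) (use f g in auto)
    then show "(\<lambda>x\<in>X. f x \<oplus>\<^bsub>regular_module A\<^esub> g x) \<in> {f. f \<in> X \<rightarrow> carrier A \<and> finite {x \<in> X. f x \<noteq> \<zero>\<^bsub>A\<^esub>}}"
      using f g by (auto simp: regular_module_def cong: conj_cong)
  qed (auto simp: regular_module_def)
qed

text \<open>Scalars of \<open>R\<close> act through r \<mapsto> r 1, and associativity of the new
  action is multiplicativity of this map.\<close>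

lemma module_restrict_scalars:
  assumes "algebra R A" "module A L" shows "module R (restrict_scalars A L)"
proof -
  interpret algebra R A by fact
  interpret L: module A L by fact
  have ag: "abelian_group (restrict_scalars A L)"
    by (rule abelian_groupI) (auto simp: restrict_scalars_def L.a_ac intro: L.M.l_neg)
  show ?thesis
  proof (rule moduleI[OF R_cring ag])
    fix a b x assume "a \<in> carrier R" "b \<in> carrier R" "x \<in> carrier (restrict_scalars A L)"
    then show "(a \<otimes>\<^bsub>R\<^esub> b) \<odot>\<^bsub>restrict_scalars A L\<^esub> x =
        a \<odot>\<^bsub>restrict_scalars A L\<^esub> (b \<odot>\<^bsub>restrict_scalars A L\<^esub> x)"
      using smult_assoc2[of a "\<one>\<^bsub>A\<^esub>" "b \<odot>\<^bsub>A\<^esub> \<one>\<^bsub>A\<^esub>"]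
      by (simp add: restrict_scalars_def L.smult_assoc1 [symmetric] smult_assoc1)
  qed (auto simp: restrict_scalars_def smult_l_distr L.smult_l_distr L.smult_r_distr)
qed

lemma a_rcosetsE:
  assumes "X \<in> a_rcosets\<^bsub>M\<^esub> N"
  obtains x where "x \<in> carrier M" "X = N +>\<^bsub>M\<^esub> x"
  using assms by (auto simp: A_RCOSETS_def' a_r_coset_def')

context
  fixes A :: "('a, 'n) ring_scheme" and M :: "('a, 'm, 'i) module_scheme" and N
  assumes mod: "module A M" and sub: "submodule N A M"
begin

interpretation module A M by (rule mod)

lemma abelian_subgroup_submodule: "abelian_subgroup N M"
  by (rule abelian_subgroupI3[OF additive_subgroupI[OF submodule.axioms(1)[OF sub]] abelian_group_axioms])

interpretation N: abelian_subgroup N M by (rule abelian_subgroup_submodule)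

text \<open>Closure of \<open>N\<close> under scalars makes all cosets in the defining union equal;
  as the coset is nonempty, the union is their common value.\<close>

lemma quotient_module_smult:
  assumes "a \<in> carrier A" "x \<in> carrier M"
  shows "a \<odot>\<^bsub>quotient_module M N\<^esub> (N +>\<^bsub>M\<^esub> x) = N +>\<^bsub>M\<^esub> (a \<odot>\<^bsub>M\<^esub> x)"
proof -
  have "N +>\<^bsub>M\<^esub> (a \<odot>\<^bsub>M\<^esub> y) = N +>\<^bsub>M\<^esub> (a \<odot>\<^bsub>M\<^esub> x)" if y: "y \<in> N +>\<^bsub>M\<^esub> x" for y
  proof -
    obtain n where n: "n \<in> N" "y = n \<oplus>\<^bsub>M\<^esub> x" using y by (auto simp: a_r_coset_def')
    then have "a \<odot>\<^bsub>M\<^esub> y = a \<odot>\<^bsub>M\<^esub> n \<oplus>\<^bsub>M\<^esub> a \<odot>\<^bsub>M\<^esub> x" using assms by (simp add: smult_r_distr)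
    moreover have "a \<odot>\<^bsub>M\<^esub> n \<in> N" using submoduleE(4)[OF sub] assms n by blast
    ultimately have "a \<odot>\<^bsub>M\<^esub> y \<in> N +>\<^bsub>M\<^esub> (a \<odot>\<^bsub>M\<^esub> x)" by (auto simp: a_r_coset_def')
    with assms show ?thesis
      by (intro N.a_repr_independence' [symmetric]) auto
  qed
  moreover have "N +>\<^bsub>M\<^esub> x \<noteq> {}" using N.a_rcos_self assms by blast
  ultimately have "(\<Union>y\<in>N +>\<^bsub>M\<^esub> x. N +>\<^bsub>M\<^esub> (a \<odot>\<^bsub>M\<^esub> y)) = N +>\<^bsub>M\<^esub> (a \<odot>\<^bsub>M\<^esub> x)"
    by (intro SUP_eq_const)
  then show ?thesis by (simp add: quotient_module_def)
qed

lemma quotient_module_add: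
  assumes "x \<in> carrier M" "y \<in> carrier M"
  shows "(N +>\<^bsub>M\<^esub> x) \<oplus>\<^bsub>quotient_module M N\<^esub> (N +>\<^bsub>M\<^esub> y) = N +>\<^bsub>M\<^esub> (x \<oplus>\<^bsub>M\<^esub> y)"
  using N.a_rcos_sum[OF assms] by (simp add: quotient_module_def)

lemma quotient_module_coset [simp]:
  "x \<in> carrier M \<Longrightarrow> N +>\<^bsub>M\<^esub> x \<in> carrier (quotient_module M N)"
  using a_rcosetsI[OF N.a_subset] by (simp add: quotient_module_def)

lemma module_quotient_module: "module A (quotient_module M N)"
proof -
  have zero: "N +>\<^bsub>M\<^esub> \<zero>\<^bsub>M\<^esub> = \<zero>\<^bsub>quotient_module M N\<^esub>"
    using a_coset_add_zero[OF N.a_subset] by (simp add: quotient_module_def)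
  have coset: "\<exists>x\<in>carrier M. X = N +>\<^bsub>M\<^esub> x" if "X \<in> carrier (quotient_module M N)" for X
    using that by (auto simp: quotient_module_def elim: a_rcosetsE)
  have ag: "abelian_group (quotient_module M N)"
  proof (rule abelian_groupI, goal_cases)
    case 2
    show ?case using quotient_module_coset[of "\<zero>\<^bsub>M\<^esub>"] by (simp add: zero)
  next
    case (6 X)
    then obtain x where x: "x \<in> carrier M" "X = N +>\<^bsub>M\<^esub> x" using coset by blast
    then show ?case
      by (intro bexI[of _ "N +>\<^bsub>M\<^esub> (\<ominus>\<^bsub>M\<^esub> x)"]) (auto simp: quotient_module_add M.l_neg zero)
  next
    case (5 X)
    then obtain x where x: "x \<in> carrier M" "X = N +>\<^bsub>M\<^esub> x" using coset by blast
    then show ?case using quotient_module_add[of "\<zero>\<^bsub>M\<^esub>" x] by (simp add: zero)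
  next
    case (3 X Y Z)
    then obtain x y z where "x \<in> carrier M" "y \<in> carrier M" "z \<in> carrier M"
      "X = N +>\<^bsub>M\<^esub> x" "Y = N +>\<^bsub>M\<^esub> y" "Z = N +>\<^bsub>M\<^esub> z" using coset by meson
    then show ?case by (simp add: quotient_module_add M.a_assoc)
  next
    case (1 X Y)
    then obtain x y where "x \<in> carrier M" "y \<in> carrier M" 
      "X = N +>\<^bsub>M\<^esub> x" "Y = N +>\<^bsub>M\<^esub> y" using coset by meson
    then show ?case by (simp add: quotient_module_add)
  next
    case (4 X Y)
    then obtain x y where "x \<in> carrier M" "y \<in> carrier M" 
      "X = N +>\<^bsub>M\<^esub> x" "Y = N +>\<^bsub>M\<^esub> y" using coset by meson
    then show ?case by (simp add: quotient_module_add M.a_comm)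
  qed
  show ?thesis
  proof (rule moduleI[OF R.is_cring ag])
    fix X assume "X \<in> carrier (quotient_module M N)"
    then obtain x where x: "x \<in> carrier M" "X = N +>\<^bsub>M\<^esub> x" using coset by blast
    then show "\<one>\<^bsub>A\<^esub> \<odot>\<^bsub>quotient_module M N\<^esub> X = X"
      by (simp add: quotient_module_smult)
    fix a assume a: "a \<in> carrier A"
    show "a \<odot>\<^bsub>quotient_module M N\<^esub> X \<in> carrier (quotient_module M N)"
      using a x by (simp add: quotient_module_smult)
    show "(a \<oplus>\<^bsub>A\<^esub> b) \<odot>\<^bsub>quotient_module M N\<^esub> X =
        a \<odot>\<^bsub>quotient_module M N\<^esub> X \<oplus>\<^bsub>quotient_module M N\<^esub> b \<odot>\<^bsub>quotient_module M N\<^esub> X"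
      "(a \<otimes>\<^bsub>A\<^esub> b) \<odot>\<^bsub>quotient_module M N\<^esub> X =
        a \<odot>\<^bsub>quotient_module M N\<^esub> (b \<odot>\<^bsub>quotient_module M N\<^esub> X)" if "b \<in> carrier A" for b
      using a x that by (simp_all add: quotient_module_smult quotient_module_add smult_l_distr smult_assoc1)
    fix Y assume "Y \<in> carrier (quotient_module M N)"
    then obtain y where "y \<in> carrier M" "Y = N +>\<^bsub>M\<^esub> y" using coset by blast
    then show "a \<odot>\<^bsub>quotient_module M N\<^esub> (X \<oplus>\<^bsub>quotient_module M N\<^esub> Y) =
        a \<odot>\<^bsub>quotient_module M N\<^esub> X \<oplus>\<^bsub>quotient_module M N\<^esub> a \<odot>\<^bsub>quotient_module M N\<^esub> Y"
      using a x by (simp add: quotient_module_smult quotient_module_add smult_r_distr)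
  qed
qed

end

section \<open>Free modules\<close>

context
  fixes A :: "('a, 'n) ring_scheme" and X :: "'x set"
  assumes A: "cring A"
begin

interpretation A: cring A by (rule A)

interpretation F: module A "free_module A X" by (rule module_free_module[OF A])

lemma free_gen_closed [simp]: "free_gen A X x \<in> carrier (free_module A X)"
  by (auto simp: free_module_def pointwise_module_def free_gen_def
    intro: finite_subset[of _ "{x}"])

text \<open>Induction on the size of the support: setting \<open>f\<close> to zero at one support
  point x leaves a smaller \<open>g\<close>, and \<open>f\<close> is \<open>g\<close> plus f(x)
  times the generator at x.\<close>

lemma free_module_induct:
  assumes "f \<in> carrier (free_module A X)" and "P \<zero>\<^bsub>free_module A X\<^esub>"
    and step: "\<And>a x g. a \<in> carrier A \<Longrightarrow> x \<in> X \<Longrightarrow> g \<in> carrier (free_module A X) \<Longrightarrow> P g \<Longrightarrow>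
      P (a \<odot>\<^bsub>free_module A X\<^esub> free_gen A X x \<oplus>\<^bsub>free_module A X\<^esub> g)"
  shows "P f"
  using assms(1)
proof (induction "card {x \<in> X. f x \<noteq> \<zero>\<^bsub>A\<^esub>}" arbitrary: f)
  case 0
  then have "f = \<zero>\<^bsub>free_module A X\<^esub>"
    by (auto simp: free_module_def pointwise_module_def regular_module_def extensional_def)
  then show ?case using assms(2) by simp
next
  case (Suc n)
  then obtain x where x: "x \<in> X" "f x \<noteq> \<zero>\<^bsub>A\<^esub>"
    by (metis (mono_tags, lifting) card.empty empty_Collect_eq nat.distinct(1))
  define g where "g = f(x := \<zero>\<^bsub>A\<^esub>)"
  have f: "f \<in> X \<rightarrow> carrier A" "f \<in> extensional X" "finite {x \<in> X. f x \<noteq> \<zero>\<^bsub>A\<^esub>}"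
    using Suc.prems by (auto simp: free_module_def pointwise_module_def)
  then have car: "f y \<in> carrier A" if "y \<in> X" for y using that by auto
  have supp: "{y \<in> X. g y \<noteq> \<zero>\<^bsub>A\<^esub>} = {y \<in> X. f y \<noteq> \<zero>\<^bsub>A\<^esub>} - {x}" by (auto simp: g_def)
  have g: "g \<in> carrier (free_module A X)"
    using f supp x by (auto simp: free_module_def pointwise_module_def g_def extensional_def)
  have "n = card {y \<in> X. g y \<noteq> \<zero>\<^bsub>A\<^esub>}"
    unfolding supp using Suc.hyps(2) f(3) x by simp
  then have "P g" using Suc.hyps(1) g by blast
  moreover have "f = f x \<odot>\<^bsub>free_module A X\<^esub> free_gen A X x \<oplus>\<^bsub>free_module A X\<^esub> g"
    using f x car by (auto simp: fun_eq_iff free_module_def pointwise_module_def regular_module_def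
      free_gen_def g_def extensional_def)
  ultimately show ?case using step[of "f x" x g] f x g by auto
qed

text \<open>The free module serves here as a direct sum of copies of the additive group of
  \<open>A\<close>, so additivity of \<open>g\<close> in its coefficient is enough. The lift sums
  \<open>g (f x) x\<close> over the support.\<close>

lemma free_module_additive_lift:
  assumes M: "abelian_group M"
    and closed: "\<And>a x. a \<in> carrier A \<Longrightarrow> x \<in> X \<Longrightarrow> g a x \<in> carrier M"
    and add: "\<And>a b x. a \<in> carrier A \<Longrightarrow> b \<in> carrier A \<Longrightarrow> x \<in> X \<Longrightarrow>
      g (a \<oplus>\<^bsub>A\<^esub> b) x = g a x \<oplus>\<^bsub>M\<^esub> g b x"
  obtains G where "abelian_group_hom (free_module A X) M G"
    and "\<And>a x. a \<in> carrier A \<Longrightarrow> x \<in> X \<Longrightarrow> G (a \<odot>\<^bsub>free_module A X\<^esub> free_gen A X x) = g a x"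
proof -
  interpret M: abelian_group M by (rule M)
  define S where "S f = {x \<in> X. f x \<noteq> \<zero>\<^bsub>A\<^esub>}" for f :: "'x \<Rightarrow> 'a"
  define G where "G f = finsum M (\<lambda>x. g (f x) x) (S f)" for f
  have zero: "g \<zero>\<^bsub>A\<^esub> x = \<zero>\<^bsub>M\<^esub>" if "x \<in> X" for x
    using add[of "\<zero>\<^bsub>A\<^esub>" "\<zero>\<^bsub>A\<^esub>" x] closed[of "\<zero>\<^bsub>A\<^esub>" x] that by simp
  have car: "f x \<in> carrier A" if "f \<in> carrier (free_module A X)" "x \<in> X" for f x
    using that by (auto simp: free_module_def pointwise_module_def)
  have fin: "finite (S f)" if "f \<in> carrier (free_module A X)" for f
    using that by (auto simp: free_module_def pointwise_module_def S_def)
  \<comment> \<open>The supports of f, h and their sum differ. Since \<open>g\<close> vanishes at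
    coefficient zero, all three sums can be taken over one larger finite set.\<close>
  have G_eq: "G f = finsum M (\<lambda>x. g (f x) x) T"
    if "f \<in> carrier (free_module A X)" "finite T" "S f \<subseteq> T" "T \<subseteq> X" for f T
    unfolding G_def using that car closed zero
    by (intro M.add.finprod_mono_neutral_cong_left) (auto simp: S_def)
  have "abelian_group_hom (free_module A X) M G"
  proof (rule abelian_group_homI[OF F.abelian_group_axioms M], rule group_hom.intro)
    show "group_hom_axioms (add_monoid (free_module A X)) (add_monoid M) G"
    proof (rule group_hom_axioms.intro, rule homI, simp_all)
      fix f h assume fh: "f \<in> carrier (free_module A X)" "h \<in> carrier (free_module A X)"
      show "G f \<in> carrier M"
        unfolding G_def using fh car closed by (intro M.finsum_closed) (auto simp: S_def)
      have val: "(f \<oplus>\<^bsub>free_module A X\<^esub> h) x = f x \<oplus>\<^bsub>A\<^esub> h x" if "x \<in> X" for x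
        using that by (simp add: free_module_def pointwise_module_def regular_module_def)
      have T: "finite (S f \<union> S h)" "S f \<union> S h \<subseteq> X" using fin fh by (auto simp: S_def)
      have "S (f \<oplus>\<^bsub>free_module A X\<^esub> h) \<subseteq> S f \<union> S h" by (auto simp: S_def val)
      then have "G (f \<oplus>\<^bsub>free_module A X\<^esub> h) =
          finsum M (\<lambda>x. g ((f \<oplus>\<^bsub>free_module A X\<^esub> h) x) x) (S f \<union> S h)"
        using T fh by (intro G_eq) auto
      also have "\<dots> = finsum M (\<lambda>x. g (f x) x \<oplus>\<^bsub>M\<^esub> g (h x) x) (S f \<union> S h)"
        using T fh car closed by (intro M.finsum_cong') (auto simp: val add subset_iff)
      also have "\<dots> = finsum M (\<lambda>x. g (f x) x) (S f \<union> S h) \<oplus>\<^bsub>M\<^esub> finsum M (\<lambda>x. g (h x) x) (S f \<union> S h)"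
        using T fh car closed by (intro M.finsum_addf) (auto simp: subset_iff)
      also have "\<dots> = G f \<oplus>\<^bsub>M\<^esub> G h" 
          using T G_eq[OF fh(1), of "S f \<union> S h"] G_eq[OF fh(2), of "S f \<union> S h"] by simp
      finally show "G (f \<oplus>\<^bsub>free_module A X\<^esub> h) = G f \<oplus>\<^bsub>M\<^esub> G h" .
    qed
  qed (use F.a_group M.a_group in auto)
  moreover have "G (a \<odot>\<^bsub>free_module A X\<^esub> free_gen A X x) = g a x" if "a \<in> carrier A" "x \<in> X" for a x
  proof -
    have val: "(a \<odot>\<^bsub>free_module A X\<^esub> free_gen A X x) y = (if y = x then a else \<zero>\<^bsub>A\<^esub>)" if "y \<in> X" for y
      using that \<open>a \<in> carrier A\<close>
      by (simp add: free_module_def pointwise_module_def regular_module_def free_gen_def)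
    have "G (a \<odot>\<^bsub>free_module A X\<^esub> free_gen A X x) =
        finsum M (\<lambda>y. g ((a \<odot>\<^bsub>free_module A X\<^esub> free_gen A X x) y) y) {x}"
      using that by (intro G_eq) (auto simp: S_def val split: if_splits)
    then show ?thesis using that closed by (simp add: val)
  qed
  ultimately show ?thesis using that by blast
qed

end

section \<open>The universal property of differentials\<close>

locale algebra_with_endomorphism = algebra R A
  for R :: "('r, 'p) ring_scheme" and A :: "('r, 'a, 'n) module_scheme" +
  fixes \<phi> :: "'a \<Rightarrow> 'a"
  assumes endomorphism: "algebra_endomorphism R A \<phi>"
begin

abbreviation F where "F \<equiv> free_module A (carrier A)"
abbreviation N where "N \<equiv> differential_submodule R A \<phi>"
abbreviation D where "D \<equiv> differentials R A \<phi>"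
abbreviation d where "d \<equiv> diff R A \<phi>"
abbreviation e where "e \<equiv> free_gen A (carrier A)"

lemma
  shows phi_closed [simp]: "a \<in> carrier A \<Longrightarrow> \<phi> a \<in> carrier A"
    and phi_mult [simp]: "a \<in> carrier A \<Longrightarrow> b \<in> carrier A \<Longrightarrow> \<phi> (a \<otimes>\<^bsub>A\<^esub> b) = \<phi> a \<otimes>\<^bsub>A\<^esub> \<phi> b"
    and phi_add [simp]: "a \<in> carrier A \<Longrightarrow> b \<in> carrier A \<Longrightarrow> \<phi> (a \<oplus>\<^bsub>A\<^esub> b) = \<phi> a \<oplus>\<^bsub>A\<^esub> \<phi> b"
    and phi_one [simp]: "\<phi> \<one>\<^bsub>A\<^esub> = \<one>\<^bsub>A\<^esub>"
    and phi_smult [simp]: "r \<in> carrier R \<Longrightarrow> a \<in> carrier A \<Longrightarrow> \<phi> (r \<odot>\<^bsub>A\<^esub> a) = r \<odot>\<^bsub>A\<^esub> \<phi> a"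
  using endomorphism
  by (auto simp: algebra_endomorphism_def linear_map_def ring_hom_closed ring_hom_mult
      ring_hom_add ring_hom_one)

interpretation F: module A F by (rule module_free_module[OF M_cring])

lemma e_closed [simp]: "e x \<in> carrier F"
  by (rule free_gen_closed[OF M_cring])

lemma differential_relations_closed: "differential_relations R A \<phi> \<subseteq> carrier F"
  by (auto simp: differential_relations_def restrict_scalars_def Let_def a_minus_def)

lemma submodule_differential_submodule: "submodule N A F"
proof -
  have *: "N = \<Inter> {t. submodule t A F \<and> differential_relations R A \<phi> \<subseteq> t}"
    by (simp add: differential_submodule_def hull_def)
  show ?thesis
  proof (rule F.submoduleI)
    \<comment> \<open>The carrier itself is a submodule containing the relations, so it is a member
      of the intersected family.\<close>
    show "N \<subseteq> carrier F"
      unfolding * using F.carrier_is_submodule differential_relations_closed by blast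
  qed (auto simp: * F.submoduleE dest: subgroup.one_closed[OF submodule.axioms(1)])
qed

lemma module_differentials: "module A D"
  unfolding differentials_def
  by (rule module_quotient_module[OF F.module_axioms submodule_differential_submodule])

sublocale D: module A D by (rule module_differentials)

interpretation N: abelian_subgroup N F
  by (rule abelian_subgroup_submodule[OF F.module_axioms submodule_differential_submodule])

lemmas coset_add = quotient_module_add[OF F.module_axioms submodule_differential_submodule,
  folded differentials_def]
lemmas coset_smult = quotient_module_smult[OF F.module_axioms submodule_differential_submodule,
  folded differentials_def]
lemmas coset_closed = quotient_module_coset[OF F.module_axioms submodule_differential_submodule,
  folded differentials_def]

lemma d_closed [simp]: "d x \<in> carrier D"
  by (simp add: diff_def coset_closed)

lemma coset_eqI:
  assumes "x \<ominus>\<^bsub>F\<^esub> y \<in> differential_relations R A \<phi>" "x \<in> carrier F" "y \<in> carrier F"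
  shows "N +>\<^bsub>F\<^esub> x = N +>\<^bsub>F\<^esub> y"
proof -
  have "x \<oplus>\<^bsub>F\<^esub> \<ominus>\<^bsub>F\<^esub> y \<in> N"
    using assms(1) hull_subset[of "differential_relations R A \<phi>"]
    unfolding differential_submodule_def a_minus_def by blast
  then have "x \<in> N +>\<^bsub>F\<^esub> y" using N.a_rcos_module assms by simp
  then show ?thesis by (intro N.a_repr_independence' [symmetric]) (use assms in auto)
qed

lemma d_linear:
  assumes "l \<in> carrier R" "m \<in> carrier R" "a \<in> carrier A" "b \<in> carrier A"
  shows "d (l \<odot>\<^bsub>A\<^esub> a \<oplus>\<^bsub>A\<^esub> m \<odot>\<^bsub>A\<^esub> b) =
    (l \<odot>\<^bsub>A\<^esub> \<one>\<^bsub>A\<^esub>) \<odot>\<^bsub>D\<^esub> d a \<oplus>\<^bsub>D\<^esub> (m \<odot>\<^bsub>A\<^esub> \<one>\<^bsub>A\<^esub>) \<odot>\<^bsub>D\<^esub> d b"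
proof -
  have "N +>\<^bsub>F\<^esub> e (l \<odot>\<^bsub>A\<^esub> a \<oplus>\<^bsub>A\<^esub> m \<odot>\<^bsub>A\<^esub> b) =
      N +>\<^bsub>F\<^esub> ((l \<odot>\<^bsub>A\<^esub> \<one>\<^bsub>A\<^esub>) \<odot>\<^bsub>F\<^esub> e a \<oplus>\<^bsub>F\<^esub> (m \<odot>\<^bsub>A\<^esub> \<one>\<^bsub>A\<^esub>) \<odot>\<^bsub>F\<^esub> e b)"
    by (rule coset_eqI)
      (use assms in \<open>auto simp: differential_relations_def restrict_scalars_def Let_def\<close>)
  then show ?thesis using assms by (simp add: diff_def coset_add coset_smult)
qed

lemma d_add:
  assumes "a \<in> carrier A" "b \<in> carrier A"
  shows "d (a \<oplus>\<^bsub>A\<^esub> b) = d a \<oplus>\<^bsub>D\<^esub> d b"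
  using d_linear[of "\<one>\<^bsub>R\<^esub>" "\<one>\<^bsub>R\<^esub>" a b] assms by simp

lemma d_smult:
  assumes "r \<in> carrier R" "a \<in> carrier A"
  shows "d (r \<odot>\<^bsub>A\<^esub> a) = (r \<odot>\<^bsub>A\<^esub> \<one>\<^bsub>A\<^esub>) \<odot>\<^bsub>D\<^esub> d a"
  using d_linear[of r "\<zero>\<^bsub>R\<^esub>" a a] assms by simp

lemma d_mult:
  assumes "a \<in> carrier A" "b \<in> carrier A"
  shows "d (a \<otimes>\<^bsub>A\<^esub> b) = \<phi> a \<odot>\<^bsub>D\<^esub> d b \<oplus>\<^bsub>D\<^esub> \<phi> b \<odot>\<^bsub>D\<^esub> d a"
proof -
  have "N +>\<^bsub>F\<^esub> e (a \<otimes>\<^bsub>A\<^esub> b) = N +>\<^bsub>F\<^esub> (\<phi> a \<odot>\<^bsub>F\<^esub> e b \<oplus>\<^bsub>F\<^esub> \<phi> b \<odot>\<^bsub>F\<^esub> e a)"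
    by (rule coset_eqI)
      (use assms in \<open>auto simp: differential_relations_def restrict_scalars_def Let_def\<close>)
  then show ?thesis using assms by (simp add: diff_def coset_add coset_smult)
qed

lemma differentials_induct [consumes 1, case_names gen add]:
  assumes "u \<in> carrier D"
    and gen: "\<And>a x. a \<in> carrier A \<Longrightarrow> x \<in> carrier A \<Longrightarrow> P (a \<odot>\<^bsub>D\<^esub> d x)"
    and add: "\<And>u v. u \<in> carrier D \<Longrightarrow> v \<in> carrier D \<Longrightarrow> P u \<Longrightarrow> P v \<Longrightarrow> P (u \<oplus>\<^bsub>D\<^esub> v)"
  shows "P u"
proof -
  obtain f where f: "f \<in> carrier F" "u = N +>\<^bsub>F\<^esub> f"
    using assms(1) by (auto simp: differentials_def quotient_module_def elim: a_rcosetsE)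
  from f(1) have "P (N +>\<^bsub>F\<^esub> f)"
  proof (rule free_module_induct[OF M_cring, where P = "\<lambda>f. P (N +>\<^bsub>F\<^esub> f)"])
    \<comment> \<open>The zero coset is 0 d0, hence an instance of the generator case.\<close>
    show "P (N +>\<^bsub>F\<^esub> \<zero>\<^bsub>F\<^esub>)"
      using gen[of "\<zero>\<^bsub>A\<^esub>" "\<zero>\<^bsub>A\<^esub>"] by (simp add: diff_def coset_smult)
  next
    fix a x g assume *: "a \<in> carrier A" "x \<in> carrier A" "g \<in> carrier F" "P (N +>\<^bsub>F\<^esub> g)"
    show "P (N +>\<^bsub>F\<^esub> (a \<odot>\<^bsub>F\<^esub> e x \<oplus>\<^bsub>F\<^esub> g))"
      using add[OF _ _ gen[of a x] *(4)] * by (simp add: diff_def coset_smult coset_add coset_closed)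
  qed
  then show ?thesis using f by simp
qed

text \<open>Here \<open>g a x\<close> stands for the value at a dx. The last three hypotheses are
  the relations for d(x + y), d(r x) and d(xy), each multiplied by a, with the resulting
  coefficients absorbed into the first argument of \<open>g\<close>.\<close>

lemma differentials_additive_lift:
  assumes B: "abelian_group B"
    and closed: "\<And>a x. a \<in> carrier A \<Longrightarrow> x \<in> carrier A \<Longrightarrow> g a x \<in> carrier B"
    and add_left: "\<And>a b x. a \<in> carrier A \<Longrightarrow> b \<in> carrier A \<Longrightarrow> x \<in> carrier A \<Longrightarrow>
      g (a \<oplus>\<^bsub>A\<^esub> b) x = g a x \<oplus>\<^bsub>B\<^esub> g b x"
    and add_right: "\<And>a x y. a \<in> carrier A \<Longrightarrow> x \<in> carrier A \<Longrightarrow> y \<in> carrier A \<Longrightarrow>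
      g a (x \<oplus>\<^bsub>A\<^esub> y) = g a x \<oplus>\<^bsub>B\<^esub> g a y"
    and smult_right: "\<And>r a x. r \<in> carrier R \<Longrightarrow> a \<in> carrier A \<Longrightarrow> x \<in> carrier A \<Longrightarrow>
      g a (r \<odot>\<^bsub>A\<^esub> x) = g (r \<odot>\<^bsub>A\<^esub> a) x"
    and mult_right: "\<And>a x y. a \<in> carrier A \<Longrightarrow> x \<in> carrier A \<Longrightarrow> y \<in> carrier A \<Longrightarrow>
      g a (x \<otimes>\<^bsub>A\<^esub> y) = g (a \<otimes>\<^bsub>A\<^esub> \<phi> x) y \<oplus>\<^bsub>B\<^esub> g (a \<otimes>\<^bsub>A\<^esub> \<phi> y) x"
  obtains G where "G \<in> carrier D \<rightarrow> carrier B"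
    and "\<And>u v. u \<in> carrier D \<Longrightarrow> v \<in> carrier D \<Longrightarrow> G (u \<oplus>\<^bsub>D\<^esub> v) = G u \<oplus>\<^bsub>B\<^esub> G v"
    and "\<And>a x. a \<in> carrier A \<Longrightarrow> x \<in> carrier A \<Longrightarrow> G (a \<odot>\<^bsub>D\<^esub> d x) = g a x"
proof -
  interpret B: abelian_group B by (rule B)
  obtain G where "abelian_group_hom F B G"
    and gen: "\<And>a x. a \<in> carrier A \<Longrightarrow> x \<in> carrier A \<Longrightarrow> G (a \<odot>\<^bsub>F\<^esub> e x) = g a x"
    using free_module_additive_lift[OF M_cring B, of "carrier A" g] closed add_left by blast
  interpret G: abelian_group_hom F B G by fact
  \<comment> \<open>The kernel of the additive map \<open>G\<close> need not be stable under
    \<open>A\<close>; \<open>K\<close> is the largest submodule inside it. Minimality of the hull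
    then gives \<open>N\<close> \<subseteq> \<open>K\<close>.\<close>
  define K where "K = {f \<in> carrier F. \<forall>c\<in>carrier A. G (c \<odot>\<^bsub>F\<^esub> f) = \<zero>\<^bsub>B\<^esub>}"
  have "submodule K A F"
    by (rule F.submoduleI)
      (auto simp: K_def F.smult_r_minus F.smult_r_distr F.smult_assoc1 [symmetric])
  moreover have "differential_relations R A \<phi> \<subseteq> K"
  proof -
    have "G (c \<odot>\<^bsub>F\<^esub> (e (l \<odot>\<^bsub>A\<^esub> a \<oplus>\<^bsub>A\<^esub> m \<odot>\<^bsub>A\<^esub> b) \<ominus>\<^bsub>F\<^esub>
        ((l \<odot>\<^bsub>A\<^esub> \<one>\<^bsub>A\<^esub>) \<odot>\<^bsub>F\<^esub> e a \<oplus>\<^bsub>F\<^esub> (m \<odot>\<^bsub>A\<^esub> \<one>\<^bsub>A\<^esub>) \<odot>\<^bsub>F\<^esub> e b))) = \<zero>\<^bsub>B\<^esub>"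
      if "l \<in> carrier R" "m \<in> carrier R" "a \<in> carrier A" "b \<in> carrier A" "c \<in> carrier A" for l m a b c
    proof -
      have "c \<otimes>\<^bsub>A\<^esub> (r \<odot>\<^bsub>A\<^esub> \<one>\<^bsub>A\<^esub>) = r \<odot>\<^bsub>A\<^esub> c" if "r \<in> carrier R" for r
        using smult_assoc2[of r "\<one>\<^bsub>A\<^esub>" c] that \<open>c \<in> carrier A\<close> by (simp add: m_comm)
      then show ?thesis
        using that closed by (simp add: a_minus_def F.smult_r_minus F.smult_r_distr
            F.smult_assoc1 [symmetric] gen add_right smult_right B.r_neg)
    qed
    moreover have "G (c \<odot>\<^bsub>F\<^esub> (e (a \<otimes>\<^bsub>A\<^esub> b) \<ominus>\<^bsub>F\<^esub> (\<phi> a \<odot>\<^bsub>F\<^esub> e b \<oplus>\<^bsub>F\<^esub> \<phi> b \<odot>\<^bsub>F\<^esub> e a))) = \<zero>\<^bsub>B\<^esub>"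
      if "a \<in> carrier A" "b \<in> carrier A" "c \<in> carrier A" for a b c
      using that closed by (simp add: a_minus_def F.smult_r_minus F.smult_r_distr
          F.smult_assoc1 [symmetric] gen mult_right B.r_neg)
    ultimately show ?thesis
      using differential_relations_closed
      unfolding K_def differential_relations_def restrict_scalars_def Let_def by auto
  qed
  ultimately have "N \<subseteq> K" unfolding differential_submodule_def by (rule hull_minimal [rotated])
  then have kernel: "G n = \<zero>\<^bsub>B\<^esub>" "n \<in> carrier F" if "n \<in> N" for n
    using that unfolding K_def by force+
  \<comment> \<open>\<open>G\<close> is constant on each coset of \<open>N\<close>, so its image of
    a coset is a singleton.\<close>
  define G' where "G' X = the_elem (G ` X)" for X
  have G': "G' (N +>\<^bsub>F\<^esub> f) = G f" if "f \<in> carrier F" for f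
  proof -
    have "G ` (N +>\<^bsub>F\<^esub> f) \<subseteq> {G f}" using that kernel by (auto simp: a_r_coset_def')
    moreover have "f \<in> N +>\<^bsub>F\<^esub> f" using N.a_rcos_self that by blast
    ultimately have "G ` (N +>\<^bsub>F\<^esub> f) = {G f}" by blast
    then show ?thesis by (simp add: G'_def)
  qed
  have coset: "\<exists>f\<in>carrier F. X = N +>\<^bsub>F\<^esub> f" if "X \<in> carrier D" for X
    using that by (auto simp: differentials_def quotient_module_def elim: a_rcosetsE)
  show ?thesis
  proof (rule that)
    show "G' \<in> carrier D \<rightarrow> carrier B" using coset G' by fastforce
    show "G' (u \<oplus>\<^bsub>D\<^esub> v) = G' u \<oplus>\<^bsub>B\<^esub> G' v" if uv: "u \<in> carrier D" "v \<in> carrier D" for u v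
    proof -
      obtain f h where "f \<in> carrier F" "h \<in> carrier F" "u = N +>\<^bsub>F\<^esub> f" "v = N +>\<^bsub>F\<^esub> h"
        using coset uv by meson
      then show ?thesis by (simp add: coset_add G')
    qed
    show "G' (a \<odot>\<^bsub>D\<^esub> d x) = g a x" if "a \<in> carrier A" "x \<in> carrier A" for a x
      using that by (simp add: diff_def coset_smult G' gen)
  qed
qed

end

section \<open>Restriction of scalars, and lifts depending on a parameter\<close>

lemma restrict_scalars_simps [simp]:
  "carrier (restrict_scalars A L) = carrier L" "zero (restrict_scalars A L) = zero L"
  "add (restrict_scalars A L) = add L"
  "smult (restrict_scalars A L) r x = (r \<odot>\<^bsub>A\<^esub> \<one>\<^bsub>A\<^esub>) \<odot>\<^bsub>L\<^esub> x"
  by (simp_all add: restrict_scalars_def)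

text \<open>The additive inverse depends only on carrier, zero and addition, which restriction of
  scalars leaves unchanged.\<close>

lemma a_inv_restrict_scalars [simp]: "a_inv (restrict_scalars A L) = a_inv L"
  by (simp add: fun_eq_iff a_inv_def m_inv_def)

lemma (in algebra) smult_one_mult:
  assumes "r \<in> carrier R" "a \<in> carrier M"
  shows "(r \<odot>\<^bsub>M\<^esub> \<one>\<^bsub>M\<^esub>) \<otimes>\<^bsub>M\<^esub> a = r \<odot>\<^bsub>M\<^esub> a"
  using assms by (simp add: smult_assoc2)

lemma (in algebra) mult_smult:
  assumes "r \<in> carrier R" "a \<in> carrier M" "b \<in> carrier M"
  shows "a \<otimes>\<^bsub>M\<^esub> (r \<odot>\<^bsub>M\<^esub> b) = r \<odot>\<^bsub>M\<^esub> (a \<otimes>\<^bsub>M\<^esub> b)"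
  using assms smult_assoc2[of r b a] by (simp add: m_comm)

text \<open>One lift is chosen for each index. The bracket needs this with the other argument as the
  index, once with an element of \<open>A\<close> and once with a differential.\<close>

lemma (in algebra_with_endomorphism) differentials_additive_lift_family:
  assumes B: "abelian_group B"
    and closed: "\<And>i a x. i \<in> I \<Longrightarrow> a \<in> carrier A \<Longrightarrow> x \<in> carrier A \<Longrightarrow> g i a x \<in> carrier B"
    and add_left: "\<And>i a b x. i \<in> I \<Longrightarrow> a \<in> carrier A \<Longrightarrow> b \<in> carrier A \<Longrightarrow> x \<in> carrier A \<Longrightarrow>
      g i (a \<oplus>\<^bsub>A\<^esub> b) x = g i a x \<oplus>\<^bsub>B\<^esub> g i b x"
    and add_right: "\<And>i a x y. i \<in> I \<Longrightarrow> a \<in> carrier A \<Longrightarrow> x \<in> carrier A \<Longrightarrow> y \<in> carrier A \<Longrightarrow>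
      g i a (x \<oplus>\<^bsub>A\<^esub> y) = g i a x \<oplus>\<^bsub>B\<^esub> g i a y"
    and smult_right: "\<And>i r a x. i \<in> I \<Longrightarrow> r \<in> carrier R \<Longrightarrow> a \<in> carrier A \<Longrightarrow> x \<in> carrier A \<Longrightarrow>
      g i a (r \<odot>\<^bsub>A\<^esub> x) = g i (r \<odot>\<^bsub>A\<^esub> a) x"
    and mult_right: "\<And>i a x y. i \<in> I \<Longrightarrow> a \<in> carrier A \<Longrightarrow> x \<in> carrier A \<Longrightarrow> y \<in> carrier A \<Longrightarrow>
      g i a (x \<otimes>\<^bsub>A\<^esub> y) = g i (a \<otimes>\<^bsub>A\<^esub> \<phi> x) y \<oplus>\<^bsub>B\<^esub> g i (a \<otimes>\<^bsub>A\<^esub> \<phi> y) x"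
  obtains G where "\<And>i u. i \<in> I \<Longrightarrow> u \<in> carrier D \<Longrightarrow> G i u \<in> carrier B"
    and "\<And>i u v. i \<in> I \<Longrightarrow> u \<in> carrier D \<Longrightarrow> v \<in> carrier D \<Longrightarrow>
      G i (u \<oplus>\<^bsub>D\<^esub> v) = G i u \<oplus>\<^bsub>B\<^esub> G i v"
    and "\<And>i a x. i \<in> I \<Longrightarrow> a \<in> carrier A \<Longrightarrow> x \<in> carrier A \<Longrightarrow> G i (a \<odot>\<^bsub>D\<^esub> d x) = g i a x"
proof -
  define Q where "Q i G \<longleftrightarrow> (\<forall>u\<in>carrier D. G u \<in> carrier B) \<and>
    (\<forall>u\<in>carrier D. \<forall>v\<in>carrier D. G (u \<oplus>\<^bsub>D\<^esub> v) = G u \<oplus>\<^bsub>B\<^esub> G v) \<and>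
    (\<forall>a\<in>carrier A. \<forall>x\<in>carrier A. G (a \<odot>\<^bsub>D\<^esub> d x) = g i a x)" for i G
  have "\<exists>G. Q i G" if i: "i \<in> I" for i
  proof -
    obtain G where "G \<in> carrier D \<rightarrow> carrier B"
      and "\<And>u v. u \<in> carrier D \<Longrightarrow> v \<in> carrier D \<Longrightarrow> G (u \<oplus>\<^bsub>D\<^esub> v) = G u \<oplus>\<^bsub>B\<^esub> G v"
      and "\<And>a x. a \<in> carrier A \<Longrightarrow> x \<in> carrier A \<Longrightarrow> G (a \<odot>\<^bsub>D\<^esub> d x) = g i a x"
      by (rule differentials_additive_lift[OF B, of "g i"])
        (use i closed add_left add_right smult_right mult_right in auto)
    then show ?thesis unfolding Q_def by blast
  qed
  then obtain G where "\<And>i. i \<in> I \<Longrightarrow> Q i (G i)" by metis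
  then show ?thesis by (intro that [of G]) (simp_all add: Q_def)
qed

section \<open>Existence of the structure maps\<close>

text \<open>As \<phi> preserves the Poisson bracket, {\<phi>(x), {y, z}} is \<phi> \<circ> \<phi>
  applied to [x, [y, z]]. So hom-Jacobi is the image of Jacobi under \<phi> \<circ> \<phi>, and the
  twisted Leibniz rule is the image of the Leibniz rule under \<phi>.\<close>

lemma purely_hom_poisson_algebra_composition:
  assumes "poisson_algebra R A P" and aut: "poisson_automorphism R A P \<phi>"
  shows "purely_hom_poisson_algebra R A (\<lambda>x y. \<phi> (P x y)) \<phi>"
proof -
  interpret poisson_algebra R A P by fact
  have endo: "algebra_endomorphism R A \<phi>" using aut by (simp add: poisson_automorphism_def)
  interpret algebra_with_endomorphism R A \<phi> by unfold_locales (rule endo)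
  interpret \<phi>: abelian_group_hom A A \<phi>
    by (rule abelian_group_homI)
      (auto intro!: group_hom.intro group_hom_axioms.intro homI M.a_group M.abelian_group_axioms)
  have P: "P x y \<in> carrier A" if "x \<in> carrier A" "y \<in> carrier A" for x y
    using bracket_bilinear that by (auto simp: bilinear_map_def linear_map_def)
  have phi_P: "\<phi> (P x y) = P (\<phi> x) (\<phi> y)" if "x \<in> carrier A" "y \<in> carrier A" for x y
    using aut that by (simp add: poisson_automorphism_def)
  show ?thesis
  proof unfold_locales
    show "bilinear_map R A A A (\<lambda>x y. \<phi> (P x y))"
      using bracket_bilinear by (auto simp: bilinear_map_def linear_map_def Pi_iff)
    show "\<phi> (P x y) = \<ominus>\<^bsub>A\<^esub> \<phi> (P y x)" if "x \<in> carrier A" "y \<in> carrier A" for x y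
      using bracket_skew[OF that] that by (simp add: P)
    show "linear_map R A A \<phi>" using endo by (simp add: algebra_endomorphism_def)
  qed (simp_all add: P phi_P bracket_jacobi bracket_derivation_right)
qed

section \<open>Calculus with the hom-Poisson bracket; existence of \<alpha> and \<pi>\<close>

locale hom_poisson_algebra_with_endomorphism =
  purely_hom_poisson_algebra R A H \<phi> + algebra_with_endomorphism R A \<phi>
  for R :: "('r, 'p) ring_scheme" and A :: "('r, 'a, 'n) module_scheme"
    and H :: "'a \<Rightarrow> 'a \<Rightarrow> 'a" and \<phi> :: "'a \<Rightarrow> 'a"
begin

lemma
  shows H_closed [simp]: "x \<in> carrier A \<Longrightarrow> y \<in> carrier A \<Longrightarrow> H x y \<in> carrier A"
    and H_add_left: "x \<in> carrier A \<Longrightarrow> y \<in> carrier A \<Longrightarrow> z \<in> carrier A \<Longrightarrow>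
      H (x \<oplus>\<^bsub>A\<^esub> y) z = H x z \<oplus>\<^bsub>A\<^esub> H y z"
    and H_add_right: "x \<in> carrier A \<Longrightarrow> y \<in> carrier A \<Longrightarrow> z \<in> carrier A \<Longrightarrow>
      H x (y \<oplus>\<^bsub>A\<^esub> z) = H x y \<oplus>\<^bsub>A\<^esub> H x z"
    and H_smult_left: "r \<in> carrier R \<Longrightarrow> x \<in> carrier A \<Longrightarrow> y \<in> carrier A \<Longrightarrow>
      H (r \<odot>\<^bsub>A\<^esub> x) y = r \<odot>\<^bsub>A\<^esub> H x y"
    and H_smult_right: "r \<in> carrier R \<Longrightarrow> x \<in> carrier A \<Longrightarrow> y \<in> carrier A \<Longrightarrow>
      H x (r \<odot>\<^bsub>A\<^esub> y) = r \<odot>\<^bsub>A\<^esub> H x y"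
  using br_bilinear by (auto simp: bilinear_map_def linear_map_def)

lemma H_mult_left:
  assumes "x \<in> carrier A" "y \<in> carrier A" "z \<in> carrier A"
  shows "H (x \<otimes>\<^bsub>A\<^esub> y) z = \<phi> x \<otimes>\<^bsub>A\<^esub> H y z \<oplus>\<^bsub>A\<^esub> \<phi> y \<otimes>\<^bsub>A\<^esub> H x z"
proof -
  have "H (x \<otimes>\<^bsub>A\<^esub> y) z = \<ominus>\<^bsub>A\<^esub> (\<phi> x \<otimes>\<^bsub>A\<^esub> H z y \<oplus>\<^bsub>A\<^esub> \<phi> y \<otimes>\<^bsub>A\<^esub> H z x)"
    using br_skew[of "x \<otimes>\<^bsub>A\<^esub> y" z] hom_leibniz[of z x y] assms by simp
  also have "\<dots> = \<phi> x \<otimes>\<^bsub>A\<^esub> (\<ominus>\<^bsub>A\<^esub> H z y) \<oplus>\<^bsub>A\<^esub> \<phi> y \<otimes>\<^bsub>A\<^esub> (\<ominus>\<^bsub>A\<^esub> H z x)"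
    using assms by (simp add: M.minus_add r_minus M.a_comm)
  also have "\<dots> = \<phi> x \<otimes>\<^bsub>A\<^esub> H y z \<oplus>\<^bsub>A\<^esub> \<phi> y \<otimes>\<^bsub>A\<^esub> H x z"
    using br_skew[of y z] br_skew[of x z] assms by simp
  finally show ?thesis .
qed

text \<open>The Leibniz rule for 1 = 1 1 gives {x, 1} = {x, 1} + {x, 1}. This kills the anchor terms
  in the bracket of dx and dy.\<close>

lemma H_one_right [simp]:
  assumes "x \<in> carrier A" shows "H x \<one>\<^bsub>A\<^esub> = \<zero>\<^bsub>A\<^esub>"
  using hom_leibniz[of x "\<one>\<^bsub>A\<^esub>" "\<one>\<^bsub>A\<^esub>"] assms by simp

lemma H_one_left [simp]:
  assumes "x \<in> carrier A" shows "H \<one>\<^bsub>A\<^esub> x = \<zero>\<^bsub>A\<^esub>"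
  using br_skew[of "\<one>\<^bsub>A\<^esub>" x] assms by simp

lemma H_minus_right:
  assumes "x \<in> carrier A" "y \<in> carrier A" shows "H x (\<ominus>\<^bsub>A\<^esub> y) = \<ominus>\<^bsub>A\<^esub> H x y"
  using H_smult_right[of "\<ominus>\<^bsub>R\<^esub> \<one>\<^bsub>R\<^esub>" x y] assms by (simp add: smult_l_minus)

lemma module_Der_module: "module A (Der_module R A \<phi>)"
  unfolding Der_module_def
proof (rule module_pointwise_module[OF module_regular_module[OF M_cring]])
qed (auto simp: regular_module_def linear_map_def Pi_iff r_distr l_distr smult_r_distr
    mult_smult m_ac M.a_ac)

lemma ex_is_alpha_tilde: "\<exists>\<alpha>. is_alpha_tilde R A \<phi> \<alpha>"
proof -
  obtain \<alpha> where "\<alpha> \<in> carrier D \<rightarrow> carrier D"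
    and add: "\<And>u v. u \<in> carrier D \<Longrightarrow> v \<in> carrier D \<Longrightarrow> \<alpha> (u \<oplus>\<^bsub>D\<^esub> v) = \<alpha> u \<oplus>\<^bsub>D\<^esub> \<alpha> v"
    and gen: "\<And>a x. a \<in> carrier A \<Longrightarrow> x \<in> carrier A \<Longrightarrow> \<alpha> (a \<odot>\<^bsub>D\<^esub> d x) = \<phi> a \<odot>\<^bsub>D\<^esub> d (\<phi> x)"
    by (rule differentials_additive_lift[OF D.M.abelian_group_axioms, of "\<lambda>a x. \<phi> a \<odot>\<^bsub>D\<^esub> d (\<phi> x)"])
      (auto simp: D.smult_l_distr D.smult_r_distr d_add d_smult d_mult
        D.smult_assoc1 [symmetric] mult_smult)
  \<comment> \<open>The lift is only additive, so \<open>R\<close>-linearity is checked separately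
    on generators.\<close>
  moreover have "\<alpha> ((r \<odot>\<^bsub>A\<^esub> \<one>\<^bsub>A\<^esub>) \<odot>\<^bsub>D\<^esub> u) = (r \<odot>\<^bsub>A\<^esub> \<one>\<^bsub>A\<^esub>) \<odot>\<^bsub>D\<^esub> \<alpha> u"
    if "r \<in> carrier R" "u \<in> carrier D" for r u
    using that(2,1) \<open>\<alpha> \<in> _ \<rightarrow> _\<close>
    by (induction u rule: differentials_induct)
      (auto simp: gen add D.smult_assoc1 [symmetric] smult_one_mult D.smult_r_distr Pi_iff)
  ultimately show ?thesis
    by (auto simp: is_alpha_tilde_def linear_map_def Let_def)
qed

text \<open>The Leibniz rule of \<open>H\<close> is used in both arguments: in the second it makes
  each value a \<phi>-derivation, in the first it is the relation for d(xy).\<close>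

lemma ex_is_pi_star: "\<exists>\<pi>. is_pi_star R A H \<phi> \<pi>"
proof -
  interpret Der: module A "Der_module R A \<phi>" by (rule module_Der_module)
  obtain \<pi> where "\<pi> \<in> carrier D \<rightarrow> carrier (Der_module R A \<phi>)"
    and add: "\<And>u v. u \<in> carrier D \<Longrightarrow> v \<in> carrier D \<Longrightarrow> \<pi> (u \<oplus>\<^bsub>D\<^esub> v) = \<pi> u \<oplus>\<^bsub>Der_module R A \<phi>\<^esub> \<pi> v"
    and gen: "\<And>a x. a \<in> carrier A \<Longrightarrow> x \<in> carrier A \<Longrightarrow> \<pi> (a \<odot>\<^bsub>D\<^esub> d x) = (\<lambda>b\<in>carrier A. a \<otimes>\<^bsub>A\<^esub> H x b)"
    by (rule differentials_additive_lift[OF Der.M.abelian_group_axioms,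
          of "\<lambda>a x. \<lambda>b\<in>carrier A. a \<otimes>\<^bsub>A\<^esub> H x b"])
      (auto simp: Der_module_def pointwise_module_def regular_module_def linear_map_def
        fun_eq_iff H_add_left H_add_right H_smult_left H_smult_right hom_leibniz H_mult_left
        l_distr r_distr mult_smult smult_assoc2 m_ac)
  moreover have "\<pi> (a \<odot>\<^bsub>D\<^esub> u) = a \<odot>\<^bsub>Der_module R A \<phi>\<^esub> \<pi> u"
    if "a \<in> carrier A" "u \<in> carrier D" for a u
    using that(2,1) \<open>\<pi> \<in> _ \<rightarrow> _\<close>
  proof (induction u rule: differentials_induct)
    case (gen b x)
    then show ?case
      by (auto simp: \<open>\<And>a x. a \<in> _ \<Longrightarrow> x \<in> _ \<Longrightarrow> \<pi> (a \<odot>\<^bsub>D\<^esub> d x) = _\<close> D.smult_assoc1 [symmetric]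
        Der_module_def pointwise_module_def regular_module_def fun_eq_iff m_assoc)
  qed (auto simp: add D.smult_r_distr Der.smult_r_distr Pi_iff)
  moreover have "\<pi> (d x) b = H x b" if "x \<in> carrier A" "b \<in> carrier A" for x b
    using gen[of "\<one>\<^bsub>A\<^esub>" x] that by simp
  ultimately show ?thesis
    by (auto simp: is_pi_star_def linear_map_def)
qed

end

section \<open>Twist and anchor on arbitrary differentials; existence of the bracket\<close>

locale differential_anchor = hom_poisson_algebra_with_endomorphism R A H \<phi>
  for R :: "('r, 'p) ring_scheme" and A :: "('r, 'a, 'n) module_scheme"
    and H :: "'a \<Rightarrow> 'a \<Rightarrow> 'a" and \<phi> :: "'a \<Rightarrow> 'a" +
  fixes \<alpha> :: "('a \<Rightarrow> 'a) set \<Rightarrow> ('a \<Rightarrow> 'a) set" and \<pi> :: "('a \<Rightarrow> 'a) set \<Rightarrow> 'a \<Rightarrow> 'a"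
  assumes alpha: "is_alpha_tilde R A \<phi> \<alpha>" and pi: "is_pi_star R A H \<phi> \<pi>"
begin

lemma
  shows alpha_closed [simp]: "u \<in> carrier D \<Longrightarrow> \<alpha> u \<in> carrier D"
    and alpha_add [simp]: "u \<in> carrier D \<Longrightarrow> v \<in> carrier D \<Longrightarrow> \<alpha> (u \<oplus>\<^bsub>D\<^esub> v) = \<alpha> u \<oplus>\<^bsub>D\<^esub> \<alpha> v"
    and alpha_gen: "a \<in> carrier A \<Longrightarrow> x \<in> carrier A \<Longrightarrow> \<alpha> (a \<odot>\<^bsub>D\<^esub> d x) = \<phi> a \<odot>\<^bsub>D\<^esub> d (\<phi> x)"
  using alpha by (auto simp: is_alpha_tilde_def linear_map_def Let_def)

lemma alpha_d [simp]: "x \<in> carrier A \<Longrightarrow> \<alpha> (d x) = d (\<phi> x)"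
  using alpha_gen[of "\<one>\<^bsub>A\<^esub>" x] by simp

text \<open>The characterisation of \<alpha> provides only \<open>R\<close>-linearity and the values
  at a dx; semilinearity follows because \<phi> is multiplicative on the coefficients.\<close>

lemma alpha_smult [simp]:
  assumes "a \<in> carrier A" "u \<in> carrier D"
  shows "\<alpha> (a \<odot>\<^bsub>D\<^esub> u) = \<phi> a \<odot>\<^bsub>D\<^esub> \<alpha> u"
  using assms(2,1)
  by (induction u rule: differentials_induct)
    (auto simp: alpha_gen D.smult_assoc1 [symmetric] D.smult_r_distr)

lemma pi_Der:
  assumes "u \<in> carrier D" shows "\<pi> u \<in> carrier (Der_module R A \<phi>)"
  using pi assms by (auto simp: is_pi_star_def linear_map_def)

lemma
  assumes "u \<in> carrier D"
  shows pi_closed [simp]: "a \<in> carrier A \<Longrightarrow> \<pi> u a \<in> carrier A"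
    and pi_add_right: "a \<in> carrier A \<Longrightarrow> b \<in> carrier A \<Longrightarrow> \<pi> u (a \<oplus>\<^bsub>A\<^esub> b) = \<pi> u a \<oplus>\<^bsub>A\<^esub> \<pi> u b"
    and pi_smult_right: "r \<in> carrier R \<Longrightarrow> a \<in> carrier A \<Longrightarrow> \<pi> u (r \<odot>\<^bsub>A\<^esub> a) = r \<odot>\<^bsub>A\<^esub> \<pi> u a"
    and pi_mult_right: "a \<in> carrier A \<Longrightarrow> b \<in> carrier A \<Longrightarrow>
      \<pi> u (a \<otimes>\<^bsub>A\<^esub> b) = \<phi> a \<otimes>\<^bsub>A\<^esub> \<pi> u b \<oplus>\<^bsub>A\<^esub> \<phi> b \<otimes>\<^bsub>A\<^esub> \<pi> u a"
    and pi_extensional: "\<pi> u \<in> extensional (carrier A)"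
  using pi_Der[OF assms] by (auto simp: Der_module_def pointwise_module_def linear_map_def)

lemma
  shows pi_add_left: "u \<in> carrier D \<Longrightarrow> v \<in> carrier D \<Longrightarrow> a \<in> carrier A \<Longrightarrow>
      \<pi> (u \<oplus>\<^bsub>D\<^esub> v) a = \<pi> u a \<oplus>\<^bsub>A\<^esub> \<pi> v a"
    and pi_smult_left: "b \<in> carrier A \<Longrightarrow> u \<in> carrier D \<Longrightarrow> a \<in> carrier A \<Longrightarrow>
      \<pi> (b \<odot>\<^bsub>D\<^esub> u) a = b \<otimes>\<^bsub>A\<^esub> \<pi> u a"
    and pi_d: "x \<in> carrier A \<Longrightarrow> a \<in> carrier A \<Longrightarrow> \<pi> (d x) a = H x a"
  using pi by (auto simp: is_pi_star_def linear_map_def Der_module_def pointwise_module_def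
      regular_module_def)

text \<open>Reduces to {\<phi>(y), \<phi>(c)} = \<phi>({y, c}) with y = \<phi>(x). It is the first
  representation axiom, and later it rewrites the coefficients that arise in nested
  brackets.\<close>

lemma anchor_twist:
  assumes "u \<in> carrier D" "c \<in> carrier A"
  shows "\<pi> (\<alpha> (\<alpha> u)) (\<phi> c) = \<phi> (\<pi> (\<alpha> u) c)"
  using assms
  by (induction u rule: differentials_induct) (auto simp: pi_add_left pi_smult_left pi_d twist_br)

text \<open>
  The bracket is built one argument at a time: \<open>L y u\<close> is the part of \<open>[u, b dy]\<close> that is
  proportional to \<open>\<phi> b\<close>.
\<close>

lemma ex_is_differential_bracket: "\<exists>br. is_differential_bracket R A H \<phi> \<alpha> (\<pi> \<circ> \<alpha>) br"
proof -
  note D_simps = D.smult_l_distr D.smult_r_distr D.smult_assoc1 [symmetric]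
  note H_simps = H_add_left H_add_right H_smult_left H_smult_right hom_leibniz H_mult_left
  \<comment> \<open>\<open>L y u\<close> is to be [u, dy]. The prescribed bracket with b = 1 gives
    the formula, with -{\<phi>(y), a} written as {a, \<phi>(y)}. In the relation for d(xx'), the
    terms \<phi>({x, y}) produced by d match the terms {\<phi>(x), \<phi>(y)} produced by the
    Leibniz rule, since \<phi> is multiplicative for \<open>H\<close>.\<close>
  obtain L where L_closed: "\<And>y u. y \<in> carrier A \<Longrightarrow> u \<in> carrier D \<Longrightarrow> L y u \<in> carrier D"
    and L_add: "\<And>y u v. y \<in> carrier A \<Longrightarrow> u \<in> carrier D \<Longrightarrow> v \<in> carrier D \<Longrightarrow>
      L y (u \<oplus>\<^bsub>D\<^esub> v) = L y u \<oplus>\<^bsub>D\<^esub> L y v"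
    and L_gen: "\<And>y a x. y \<in> carrier A \<Longrightarrow> a \<in> carrier A \<Longrightarrow> x \<in> carrier A \<Longrightarrow>
      L y (a \<odot>\<^bsub>D\<^esub> d x) = \<phi> a \<odot>\<^bsub>D\<^esub> d (H x y) \<oplus>\<^bsub>D\<^esub> H a (\<phi> y) \<odot>\<^bsub>D\<^esub> d (\<phi> x)"
    by (rule differentials_additive_lift_family[OF D.M.abelian_group_axioms, of "carrier A"
        "\<lambda>y a x. \<phi> a \<odot>\<^bsub>D\<^esub> d (H x y) \<oplus>\<^bsub>D\<^esub> H a (\<phi> y) \<odot>\<^bsub>D\<^esub> d (\<phi> x)"])
      ((simp add: H_simps D_simps d_add d_smult d_mult D.M.a_ac mult_smult
        smult_assoc2 l_distr r_distr twist_br m_ac; fail) | blast)+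
  have L_add_left: "L (x \<oplus>\<^bsub>A\<^esub> y) u = L x u \<oplus>\<^bsub>D\<^esub> L y u"
    if "u \<in> carrier D" "x \<in> carrier A" "y \<in> carrier A" for x y u
    using that
    by (induction u rule: differentials_induct)
      (auto simp: L_gen L_add L_closed H_simps D_simps d_add D.M.a_ac)
  have L_smult_left: "L (r \<odot>\<^bsub>A\<^esub> y) u = (r \<odot>\<^bsub>A\<^esub> \<one>\<^bsub>A\<^esub>) \<odot>\<^bsub>D\<^esub> L y u"
    if "u \<in> carrier D" "r \<in> carrier R" "y \<in> carrier A" for r y u
    using that
    by (induction u rule: differentials_induct)
      (auto simp: L_gen L_add L_closed H_simps D_simps d_smult smult_assoc2 mult_smult)
  \<comment> \<open>This is [u, d(xy)] = [u, \<phi>(x) dy] + [u, \<phi>(y) dx], both brackets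
    expanded by the Leibniz rule. It is what the second lift needs for its product relation.\<close>
  have L_mult_left: "L (x \<otimes>\<^bsub>A\<^esub> y) u = \<phi> (\<phi> x) \<odot>\<^bsub>D\<^esub> L y u \<oplus>\<^bsub>D\<^esub> \<pi> (\<alpha> u) (\<phi> x) \<odot>\<^bsub>D\<^esub> d (\<phi> y)
      \<oplus>\<^bsub>D\<^esub> (\<phi> (\<phi> y) \<odot>\<^bsub>D\<^esub> L x u \<oplus>\<^bsub>D\<^esub> \<pi> (\<alpha> u) (\<phi> y) \<odot>\<^bsub>D\<^esub> d (\<phi> x))"
    if "u \<in> carrier D" "x \<in> carrier A" "y \<in> carrier A" for x y u
    using that
    by (induction u rule: differentials_induct)
      (simp_all add: L_gen L_add L_closed H_simps D_simps d_add d_mult D.M.a_ac m_ac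
        twist_br pi_add_left pi_smult_left pi_d)
  have L_smult: "L y ((r \<odot>\<^bsub>A\<^esub> \<one>\<^bsub>A\<^esub>) \<odot>\<^bsub>D\<^esub> u) = (r \<odot>\<^bsub>A\<^esub> \<one>\<^bsub>A\<^esub>) \<odot>\<^bsub>D\<^esub> L y u"
    if "u \<in> carrier D" "r \<in> carrier R" "y \<in> carrier A" for r y u
    using that
    by (induction u rule: differentials_induct)
      (auto simp: L_gen L_add L_closed H_simps D_simps smult_assoc2 mult_smult)
  \<comment> \<open>Now u is the parameter, and the prescribed value is the Leibniz rule for
    [u, b dy] with \<open>L y u\<close> in place of [u, dy].\<close>
  obtain br where br_closed: "\<And>u v. u \<in> carrier D \<Longrightarrow> v \<in> carrier D \<Longrightarrow> br u v \<in> carrier D"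
    and br_add: "\<And>u v w. u \<in> carrier D \<Longrightarrow> v \<in> carrier D \<Longrightarrow> w \<in> carrier D \<Longrightarrow>
      br u (v \<oplus>\<^bsub>D\<^esub> w) = br u v \<oplus>\<^bsub>D\<^esub> br u w"
    and br_gen: "\<And>u b y. u \<in> carrier D \<Longrightarrow> b \<in> carrier A \<Longrightarrow> y \<in> carrier A \<Longrightarrow>
      br u (b \<odot>\<^bsub>D\<^esub> d y) = \<phi> b \<odot>\<^bsub>D\<^esub> L y u \<oplus>\<^bsub>D\<^esub> \<pi> (\<alpha> u) b \<odot>\<^bsub>D\<^esub> d (\<phi> y)"
    by (rule differentials_additive_lift_family[OF D.M.abelian_group_axioms, of "carrier D"
        "\<lambda>u b y. \<phi> b \<odot>\<^bsub>D\<^esub> L y u \<oplus>\<^bsub>D\<^esub> \<pi> (\<alpha> u) b \<odot>\<^bsub>D\<^esub> d (\<phi> y)"])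
      ((simp add: L_add_left L_smult_left L_mult_left L_closed D_simps
        d_add d_smult d_mult D.M.a_ac mult_smult smult_assoc2 m_ac
        pi_add_right pi_smult_right pi_mult_right; fail) | blast)+
  have br_add_left: "br (u \<oplus>\<^bsub>D\<^esub> v) w = br u w \<oplus>\<^bsub>D\<^esub> br v w"
    if "w \<in> carrier D" "u \<in> carrier D" "v \<in> carrier D" for u v w
    using that
    by (induction w rule: differentials_induct)
      (simp_all add: br_gen br_add br_closed L_add L_closed D_simps D.M.a_ac pi_add_left)
  have br_smult: "br u ((r \<odot>\<^bsub>A\<^esub> \<one>\<^bsub>A\<^esub>) \<odot>\<^bsub>D\<^esub> v) = (r \<odot>\<^bsub>A\<^esub> \<one>\<^bsub>A\<^esub>) \<odot>\<^bsub>D\<^esub> br u v"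
    if "v \<in> carrier D" "r \<in> carrier R" "u \<in> carrier D" for r u v
    using that
    by (induction v rule: differentials_induct)
      (simp_all add: br_gen br_add br_closed L_closed D_simps smult_assoc2 mult_smult pi_smult_right)
  have br_smult_left: "br ((r \<odot>\<^bsub>A\<^esub> \<one>\<^bsub>A\<^esub>) \<odot>\<^bsub>D\<^esub> u) v = (r \<odot>\<^bsub>A\<^esub> \<one>\<^bsub>A\<^esub>) \<odot>\<^bsub>D\<^esub> br u v"
    if "v \<in> carrier D" "r \<in> carrier R" "u \<in> carrier D" for r u v
    using that
    by (induction v rule: differentials_induct)
      (simp_all add: br_gen br_add br_closed L_smult L_closed D_simps smult_assoc2 mult_smult pi_smult_left)
  \<comment> \<open>Skew-symmetry of \<open>H\<close> turns the summand with {a, \<phi>(y)} back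
    into the subtracted anchor term.\<close>
  have "br (a \<odot>\<^bsub>D\<^esub> d x) (b \<odot>\<^bsub>D\<^esub> d y) =
      (\<phi> a \<otimes>\<^bsub>A\<^esub> \<phi> b) \<odot>\<^bsub>D\<^esub> d (H x y) \<oplus>\<^bsub>D\<^esub> \<pi> (\<alpha> (a \<odot>\<^bsub>D\<^esub> d x)) b \<odot>\<^bsub>D\<^esub> \<alpha> (d y)
        \<ominus>\<^bsub>D\<^esub> \<pi> (\<alpha> (b \<odot>\<^bsub>D\<^esub> d y)) a \<odot>\<^bsub>D\<^esub> \<alpha> (d x)"
    if "a \<in> carrier A" "b \<in> carrier A" "x \<in> carrier A" "y \<in> carrier A" for a b x y
    using that br_skew[of a "\<phi> y"]
    by (simp add: br_gen L_gen D_simps pi_smult_left pi_d a_minus_def r_minus D.smult_l_minus D.smult_r_minus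
        D.M.a_ac m_ac)
  then show ?thesis
    using br_closed br_add br_add_left br_smult br_smult_left
    by (intro exI [of _ br])
      (simp add: is_differential_bracket_def bilinear_map_def linear_map_def Let_def Pi_iff)
qed

end

section \<open>The hom-Lie-Rinehart axioms\<close>

lemma (in abelian_group) eq_if_minus_eq_zero:
  assumes "x \<oplus> \<ominus> y = \<zero>" "x \<in> carrier G" "y \<in> carrier G"
  shows "x = y"
  using minus_equality[of x "\<ominus> y"] assms by simp

text \<open>The cancellation behind the jacobiator formula, isolated in a bare abelian group: y, z,
  s and t are the anchor terms, and each occurs once with either sign.\<close>

lemma (in abelian_group) jacobi_rearrange:
  assumes "x1 \<in> carrier G" "x2 \<in> carrier G" "x3 \<in> carrier G" "y \<in> carrier G" "z \<in> carrier G"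
    "s \<in> carrier G" "t \<in> carrier G"
  shows "(x1 \<oplus> y \<oplus> (z \<oplus> (s \<oplus> t))) \<oplus> (x2 \<ominus> z \<ominus> (y \<oplus> t)) \<oplus> (x3 \<ominus> s) =
    x1 \<oplus> x2 \<oplus> x3"
proof -
  have "(x1 \<oplus> y \<oplus> (z \<oplus> (s \<oplus> t))) \<oplus> (x2 \<ominus> z \<ominus> (y \<oplus> t)) \<oplus> (x3 \<ominus> s) =
    (x1 \<oplus> x2 \<oplus> x3) \<oplus> ((y \<oplus> z \<oplus> s \<oplus> t) \<ominus> (y \<oplus> z \<oplus> s \<oplus> t))"
    using assms by (simp add: a_minus_def minus_add a_ac)
  also have "(y \<oplus> z \<oplus> s \<oplus> t) \<ominus> (y \<oplus> z \<oplus> s \<oplus> t) = \<zero>"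
    unfolding a_minus_def using assms by (intro r_neg) simp
  finally show ?thesis using assms by simp
qed

locale differential_bracket = differential_anchor R A H \<phi> \<alpha> \<pi>
  for R :: "('r, 'p) ring_scheme" and A :: "('r, 'a, 'n) module_scheme"
    and H :: "'a \<Rightarrow> 'a \<Rightarrow> 'a" and \<phi> :: "'a \<Rightarrow> 'a"
    and \<alpha> :: "('a \<Rightarrow> 'a) set \<Rightarrow> ('a \<Rightarrow> 'a) set" and \<pi> :: "('a \<Rightarrow> 'a) set \<Rightarrow> 'a \<Rightarrow> 'a" +
  fixes br :: "('a \<Rightarrow> 'a) set \<Rightarrow> ('a \<Rightarrow> 'a) set \<Rightarrow> ('a \<Rightarrow> 'a) set"
  assumes bracket: "is_differential_bracket R A H \<phi> \<alpha> (\<pi> \<circ> \<alpha>) br"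
begin

lemma
  assumes "u \<in> carrier D" "v \<in> carrier D"
  shows br_closed [simp]: "br u v \<in> carrier D"
    and br_add_left: "w \<in> carrier D \<Longrightarrow> br (u \<oplus>\<^bsub>D\<^esub> v) w = br u w \<oplus>\<^bsub>D\<^esub> br v w"
    and br_add_right: "w \<in> carrier D \<Longrightarrow> br u (v \<oplus>\<^bsub>D\<^esub> w) = br u v \<oplus>\<^bsub>D\<^esub> br u w"
  using bracket assms
  by (auto simp: is_differential_bracket_def bilinear_map_def linear_map_def Let_def)

text \<open>Expanding the anchor and absorbing the minus sign into {a, \<phi>(y)} leaves three
  positive terms in \<open>H\<close> and \<phi> alone, the form used by the checks on
  generators.\<close>

lemma br_gen:
  assumes "a \<in> carrier A" "b \<in> carrier A" "x \<in> carrier A" "y \<in> carrier A"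
  shows "br (a \<odot>\<^bsub>D\<^esub> d x) (b \<odot>\<^bsub>D\<^esub> d y) = (\<phi> a \<otimes>\<^bsub>A\<^esub> \<phi> b) \<odot>\<^bsub>D\<^esub> d (H x y)
    \<oplus>\<^bsub>D\<^esub> (\<phi> a \<otimes>\<^bsub>A\<^esub> H (\<phi> x) b) \<odot>\<^bsub>D\<^esub> d (\<phi> y) \<oplus>\<^bsub>D\<^esub> (\<phi> b \<otimes>\<^bsub>A\<^esub> H a (\<phi> y)) \<odot>\<^bsub>D\<^esub> d (\<phi> x)"
proof -
  have "br (a \<odot>\<^bsub>D\<^esub> d x) (b \<odot>\<^bsub>D\<^esub> d y) = (\<phi> a \<otimes>\<^bsub>A\<^esub> \<phi> b) \<odot>\<^bsub>D\<^esub> d (H x y)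
      \<oplus>\<^bsub>D\<^esub> \<pi> (\<alpha> (a \<odot>\<^bsub>D\<^esub> d x)) b \<odot>\<^bsub>D\<^esub> \<alpha> (d y) \<ominus>\<^bsub>D\<^esub> \<pi> (\<alpha> (b \<odot>\<^bsub>D\<^esub> d y)) a \<odot>\<^bsub>D\<^esub> \<alpha> (d x)"
    using bracket assms by (auto simp: is_differential_bracket_def Let_def)
  then show ?thesis
    using assms br_skew[of a "\<phi> y"]
    by (simp add: pi_smult_left pi_d a_minus_def r_minus D.smult_l_minus)
qed

lemma br_d:
  assumes "x \<in> carrier A" "y \<in> carrier A"
  shows "br (d x) (d y) = d (H x y)"
  using br_gen[of "\<one>\<^bsub>A\<^esub>" "\<one>\<^bsub>A\<^esub>" x y] assms by simp

text \<open>On generators the point is {\<phi>(x), c b} = \<phi>(c) {\<phi>(x), b} + \<phi>(b)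
  {\<phi>(x), c}; the second summand becomes the anchor term.\<close>

lemma br_smult_right:
  assumes "u \<in> carrier D" "v \<in> carrier D" "c \<in> carrier A"
  shows "br u (c \<odot>\<^bsub>D\<^esub> v) = \<phi> c \<odot>\<^bsub>D\<^esub> br u v \<oplus>\<^bsub>D\<^esub> \<pi> (\<alpha> u) c \<odot>\<^bsub>D\<^esub> \<alpha> v"
  using assms
proof (induction u arbitrary: v rule: differentials_induct)
  case (gen a x)
  from gen(3,1,2,4) show ?case
  proof (induction v rule: differentials_induct)
    case (gen b y)
    then show ?case
      by (simp add: D.smult_assoc1 [symmetric] D.smult_l_distr D.smult_r_distr br_gen pi_smult_left pi_d
          hom_leibniz r_distr m_ac D.M.a_ac)
  qed (simp add: D.smult_r_distr br_add_right D.M.a_ac)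
qed (simp add: br_add_left pi_add_left D.smult_r_distr D.smult_l_distr D.M.a_ac)

text \<open>Exchanging the generators swaps the last two terms of \<open>br_gen\<close>, and every
  occurrence of \<open>H\<close> contributes a sign.\<close>

lemma differential_br_skew:
  assumes "u \<in> carrier D" "v \<in> carrier D"
  shows "br u v = \<ominus>\<^bsub>D\<^esub> br v u"
  using assms
proof (induction u arbitrary: v rule: differentials_induct)
  case (gen a x)
  from gen(3,1,2) show ?case
  proof (induction v rule: differentials_induct)
    case (gen b y)
    have neg: "d (\<ominus>\<^bsub>A\<^esub> z) = \<ominus>\<^bsub>D\<^esub> d z" if "z \<in> carrier A" for z
      using d_smult[of "\<ominus>\<^bsub>R\<^esub> \<one>\<^bsub>R\<^esub>" z] that by (simp add: smult_l_minus D.smult_l_minus)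
    show ?case
      using gen br_skew[of x y] br_skew[of "\<phi> x" b] br_skew[of a "\<phi> y"]
      by (simp add: br_gen neg r_minus D.smult_l_minus D.smult_r_minus D.M.minus_add m_ac D.M.a_ac)
  qed (simp add: br_add_left br_add_right D.M.minus_add D.M.a_ac)
qed (simp add: br_add_left br_add_right D.M.minus_add D.M.a_ac)

lemma br_smult_left:
  assumes "u \<in> carrier D" "v \<in> carrier D" "c \<in> carrier A"
  shows "br (c \<odot>\<^bsub>D\<^esub> u) v = \<phi> c \<odot>\<^bsub>D\<^esub> br u v \<ominus>\<^bsub>D\<^esub> \<pi> (\<alpha> v) c \<odot>\<^bsub>D\<^esub> \<alpha> u"
  using differential_br_skew[of "c \<odot>\<^bsub>D\<^esub> u" v] differential_br_skew[of u v] br_smult_right[of v u c] assms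
  by (simp add: a_minus_def D.M.minus_add D.smult_r_minus)

lemma alpha_br:
  assumes "u \<in> carrier D" "v \<in> carrier D"
  shows "\<alpha> (br u v) = br (\<alpha> u) (\<alpha> v)"
  using assms
proof (induction u arbitrary: v rule: differentials_induct)
  case (gen a x)
  from gen(3,1,2) show ?case
    by (induction v rule: differentials_induct) (simp_all add: br_gen br_add_right twist_br)
qed (simp add: br_add_left)

text \<open>The representation identity, with the subtracted term moved to the left-hand side.\<close>

lemma anchor_br:
  assumes "u \<in> carrier D" "v \<in> carrier D" "c \<in> carrier A"
  shows "\<pi> (\<alpha> (br u v)) (\<phi> c) \<oplus>\<^bsub>A\<^esub> \<pi> (\<alpha> (\<alpha> v)) (\<pi> (\<alpha> u) c) = \<pi> (\<alpha> (\<alpha> u)) (\<pi> (\<alpha> v) c)"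
proof -
  let ?P = "\<lambda>u v. \<pi> (\<alpha> (br u v)) (\<phi> c) \<oplus>\<^bsub>A\<^esub> \<pi> (\<alpha> (\<alpha> v)) (\<pi> (\<alpha> u) c) = \<pi> (\<alpha> (\<alpha> u)) (\<pi> (\<alpha> v) c)"
  note [simp] = \<open>c \<in> carrier A\<close>
  \<comment> \<open>Both sides acquire the factor \<phi>(\<phi>(b)) and the same extra term: on the
    left it comes from the anchor part of [u, b v], on the right from the derivation rule for
    \<phi>(b) times \<rho>(v)(c).\<close>
  have smult: "?P u (b \<odot>\<^bsub>D\<^esub> v)" if "?P u v" "u \<in> carrier D" "v \<in> carrier D" "b \<in> carrier A" for u v b
  proof -
    have "\<pi> (\<alpha> (br u (b \<odot>\<^bsub>D\<^esub> v))) (\<phi> c) \<oplus>\<^bsub>A\<^esub> \<pi> (\<alpha> (\<alpha> (b \<odot>\<^bsub>D\<^esub> v))) (\<pi> (\<alpha> u) c) =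
        \<phi> (\<phi> b) \<otimes>\<^bsub>A\<^esub> (\<pi> (\<alpha> (br u v)) (\<phi> c) \<oplus>\<^bsub>A\<^esub> \<pi> (\<alpha> (\<alpha> v)) (\<pi> (\<alpha> u) c)) \<oplus>\<^bsub>A\<^esub>
          \<phi> (\<pi> (\<alpha> u) b) \<otimes>\<^bsub>A\<^esub> \<phi> (\<pi> (\<alpha> v) c)"
      using that(2-) by (simp add: br_smult_right pi_add_left pi_smult_left anchor_twist r_distr M.a_ac)
    also have "\<dots> = \<pi> (\<alpha> (\<alpha> u)) (\<pi> (\<alpha> (b \<odot>\<^bsub>D\<^esub> v)) c)"
      unfolding that(1) using that(2-)
      by (simp add: pi_smult_left pi_mult_right anchor_twist M.a_ac m_ac)
    finally show ?thesis .
  qed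
  \<comment> \<open>Substituting the known identity leaves a bracket term and its negative, which
    cancel.\<close>
  have swap: "?P v u" if "?P u v" "u \<in> carrier D" "v \<in> carrier D" for u v
  proof -
    have "\<pi> (\<ominus>\<^bsub>D\<^esub> w) (\<phi> c) = \<ominus>\<^bsub>A\<^esub> \<pi> w (\<phi> c)" if "w \<in> carrier D" for w
      using pi_smult_left[of "\<ominus>\<^bsub>A\<^esub> \<one>\<^bsub>A\<^esub>" w "\<phi> c"] that by (simp add: D.smult_l_minus l_minus)
    moreover have "\<alpha> (br v u) = \<ominus>\<^bsub>D\<^esub> \<alpha> (br u v)"
      using differential_br_skew[of "\<alpha> v" "\<alpha> u"] that by (simp add: alpha_br)
    ultimately show ?thesis
      unfolding that(1) [symmetric] using that(2-) by (simp add: M.r_neg1)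
  qed
  \<comment> \<open>The anchor already contains one \<alpha>, so hom-Jacobi is needed at \<phi>(x),
    \<phi>(y) and c.\<close>
  have base: "?P (d x) (d y)" if "x \<in> carrier A" "y \<in> carrier A" for x y
  proof -
    have "H (\<phi> (\<phi> x)) (H (\<phi> y) c) \<oplus>\<^bsub>A\<^esub> H (\<phi> (\<phi> y)) (H c (\<phi> x)) \<oplus>\<^bsub>A\<^esub> H (\<phi> c) (H (\<phi> x) (\<phi> y)) = \<zero>\<^bsub>A\<^esub>"
      using hom_jacobi[of "\<phi> x" "\<phi> y" c] that by simp
    moreover have "H (\<phi> (\<phi> y)) (H c (\<phi> x)) = \<ominus>\<^bsub>A\<^esub> H (\<phi> (\<phi> y)) (H (\<phi> x) c)"
      using br_skew[of c "\<phi> x"] that by (simp add: H_minus_right)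
    moreover have "H (\<phi> c) (H (\<phi> x) (\<phi> y)) = \<ominus>\<^bsub>A\<^esub> H (H (\<phi> x) (\<phi> y)) (\<phi> c)"
      using that by (intro br_skew) simp_all
    ultimately have "H (\<phi> (\<phi> x)) (H (\<phi> y) c) \<oplus>\<^bsub>A\<^esub>
        \<ominus>\<^bsub>A\<^esub> (H (H (\<phi> x) (\<phi> y)) (\<phi> c) \<oplus>\<^bsub>A\<^esub> H (\<phi> (\<phi> y)) (H (\<phi> x) c)) = \<zero>\<^bsub>A\<^esub>"
      using that by (simp add: M.minus_add M.a_ac)
    from M.eq_if_minus_eq_zero [OF this] have "H (\<phi> (\<phi> x)) (H (\<phi> y) c) =
        H (H (\<phi> x) (\<phi> y)) (\<phi> c) \<oplus>\<^bsub>A\<^esub> H (\<phi> (\<phi> y)) (H (\<phi> x) c)"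
      using that by simp
    then show ?thesis
      using that by (simp add: br_d pi_d twist_br)
  qed
  have add_left: "?P (u \<oplus>\<^bsub>D\<^esub> w) v"
    if "?P u v" "?P w v" "u \<in> carrier D" "v \<in> carrier D" "w \<in> carrier D" for u v w
    using that(3-)
    by (simp add: br_add_left pi_add_left pi_add_right that(1,2) [symmetric] M.a_ac)
  \<comment> \<open>Scalars can be inserted only in the second slot and sums only in the first;
    \<open>swap\<close> carries both to the other slot.\<close>
  have gen_d: "?P u (d y)" if "u \<in> carrier D" "y \<in> carrier A" for u y
    using that
  proof (induction u rule: differentials_induct)
    case (gen a x)
    show ?case by (rule swap[OF smult[OF base]]) (use gen in simp_all)
  qed (rule add_left; simp)
  show ?thesis
    using assms(2,1)
  proof (induction v rule: differentials_induct)
    case (gen b y)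
    show ?case by (rule smult[OF gen_d]) (use gen in simp_all)
  next
    case (add v w)
    show ?case by (rule swap[OF add_left[OF swap swap]]) (use add in simp_all)
  qed
qed

lemma differential_jacobi:
  assumes "u \<in> carrier D" "v \<in> carrier D" "w \<in> carrier D"
  shows "br (\<alpha> u) (br v w) \<oplus>\<^bsub>D\<^esub> br (\<alpha> v) (br w u) \<oplus>\<^bsub>D\<^esub> br (\<alpha> w) (br u v) = \<zero>\<^bsub>D\<^esub>"
proof -
  define J where "J u v w = br (\<alpha> u) (br v w) \<oplus>\<^bsub>D\<^esub> br (\<alpha> v) (br w u) \<oplus>\<^bsub>D\<^esub> br (\<alpha> w) (br u v)" for u v w
  \<comment> \<open>Each of the two nested brackets applies \<phi> once to the coefficient, whence
    \<phi>(\<phi>(c)).\<close>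
  have smult: "J u v (c \<odot>\<^bsub>D\<^esub> w) = \<phi> (\<phi> c) \<odot>\<^bsub>D\<^esub> J u v w"
    if [simp]: "u \<in> carrier D" "v \<in> carrier D" "w \<in> carrier D" "c \<in> carrier A" for u v w c
  proof -
    \<comment> \<open>\<open>s\<close>, \<open>t\<close> and the next pair \<open>y\<close>,
      \<open>z\<close> are the surplus terms. The first summand of the jacobiator contributes all
      four, the second removes \<open>y\<close>, \<open>z\<close> and \<open>t\<close>, the third
      removes \<open>s\<close>. The representation identity is what splits the term in
      \<rho>(\<alpha> u)(\<rho>(v)(c)) into \<open>s\<close> and \<open>t\<close>.\<close>
    define s t where "s = \<pi> (\<alpha> (br u v)) (\<phi> c) \<odot>\<^bsub>D\<^esub> \<alpha> (\<alpha> w)"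
      and "t = \<pi> (\<alpha> (\<alpha> v)) (\<pi> (\<alpha> u) c) \<odot>\<^bsub>D\<^esub> \<alpha> (\<alpha> w)"
    define y z where "y = \<phi> (\<pi> (\<alpha> u) c) \<odot>\<^bsub>D\<^esub> \<alpha> (br v w)" and "z = \<phi> (\<pi> (\<alpha> v) c) \<odot>\<^bsub>D\<^esub> \<alpha> (br u w)"
    have closed: "y \<in> carrier D" "z \<in> carrier D" "s \<in> carrier D" "t \<in> carrier D"
      by (simp_all add: s_def t_def y_def z_def)
    have st: "\<pi> (\<alpha> (\<alpha> u)) (\<pi> (\<alpha> v) c) \<odot>\<^bsub>D\<^esub> \<alpha> (\<alpha> w) = s \<oplus>\<^bsub>D\<^esub> t"
      by (simp add: s_def t_def anchor_br [of u v c, symmetric] D.smult_l_distr)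
    have skew: "\<alpha> (br w u) = \<ominus>\<^bsub>D\<^esub> \<alpha> (br u w)"
      using differential_br_skew[of "\<alpha> w" "\<alpha> u"] by (simp add: alpha_br)
    have "br (\<alpha> u) (br v (c \<odot>\<^bsub>D\<^esub> w)) = \<phi> (\<phi> c) \<odot>\<^bsub>D\<^esub> br (\<alpha> u) (br v w) \<oplus>\<^bsub>D\<^esub> y \<oplus>\<^bsub>D\<^esub> (z \<oplus>\<^bsub>D\<^esub> (s \<oplus>\<^bsub>D\<^esub> t))"
      by (simp add: br_smult_right br_add_right st [symmetric] y_def z_def anchor_twist alpha_br)
    moreover have "br (\<alpha> v) (br (c \<odot>\<^bsub>D\<^esub> w) u) =
        \<phi> (\<phi> c) \<odot>\<^bsub>D\<^esub> br (\<alpha> v) (br w u) \<ominus>\<^bsub>D\<^esub> z \<ominus>\<^bsub>D\<^esub> (y \<oplus>\<^bsub>D\<^esub> t)"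
    proof -
      have "br (c \<odot>\<^bsub>D\<^esub> w) u = \<phi> c \<odot>\<^bsub>D\<^esub> br w u \<oplus>\<^bsub>D\<^esub> (\<ominus>\<^bsub>A\<^esub> \<pi> (\<alpha> u) c) \<odot>\<^bsub>D\<^esub> \<alpha> w"
        by (simp add: br_smult_left a_minus_def D.smult_l_minus)
      moreover have "\<phi> (\<ominus>\<^bsub>A\<^esub> \<pi> (\<alpha> u) c) = \<ominus>\<^bsub>A\<^esub> \<phi> (\<pi> (\<alpha> u) c)"
        "\<pi> (\<alpha> (\<alpha> v)) (\<ominus>\<^bsub>A\<^esub> \<pi> (\<alpha> u) c) = \<ominus>\<^bsub>A\<^esub> \<pi> (\<alpha> (\<alpha> v)) (\<pi> (\<alpha> u) c)"
        using phi_smult[of "\<ominus>\<^bsub>R\<^esub> \<one>\<^bsub>R\<^esub>" "\<pi> (\<alpha> u) c"]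
          pi_smult_right[of "\<alpha> (\<alpha> v)" "\<ominus>\<^bsub>R\<^esub> \<one>\<^bsub>R\<^esub>" "\<pi> (\<alpha> u) c"]
        by (simp_all add: smult_l_minus)
      ultimately have "br (\<alpha> v) (br (c \<odot>\<^bsub>D\<^esub> w) u) =
          \<phi> (\<phi> c) \<odot>\<^bsub>D\<^esub> br (\<alpha> v) (br w u) \<oplus>\<^bsub>D\<^esub> \<phi> (\<pi> (\<alpha> v) c) \<odot>\<^bsub>D\<^esub> \<alpha> (br w u) \<oplus>\<^bsub>D\<^esub>
          ((\<ominus>\<^bsub>A\<^esub> \<phi> (\<pi> (\<alpha> u) c)) \<odot>\<^bsub>D\<^esub> \<alpha> (br v w) \<oplus>\<^bsub>D\<^esub>
            (\<ominus>\<^bsub>A\<^esub> \<pi> (\<alpha> (\<alpha> v)) (\<pi> (\<alpha> u) c)) \<odot>\<^bsub>D\<^esub> \<alpha> (\<alpha> w))"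
        by (simp add: br_smult_right br_add_right anchor_twist alpha_br)
      then show ?thesis
        by (simp add: skew D.smult_l_minus D.smult_r_minus y_def z_def t_def a_minus_def
            D.M.minus_add D.M.a_ac)
    qed
    moreover have "br (\<alpha> (c \<odot>\<^bsub>D\<^esub> w)) (br u v) = \<phi> (\<phi> c) \<odot>\<^bsub>D\<^esub> br (\<alpha> w) (br u v) \<ominus>\<^bsub>D\<^esub> s"
      by (simp add: br_smult_left s_def)
    ultimately show ?thesis
      unfolding J_def using D.jacobi_rearrange closed by (simp add: D.smult_r_distr)
  qed
  have cycle: "J u v w = J v w u" if "u \<in> carrier D" "v \<in> carrier D" "w \<in> carrier D" for u v w
    using that by (simp add: J_def D.M.a_ac)
  have add: "J u v (w \<oplus>\<^bsub>D\<^esub> w') = J u v w \<oplus>\<^bsub>D\<^esub> J u v w'"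
    if "u \<in> carrier D" "v \<in> carrier D" "w \<in> carrier D" "w' \<in> carrier D" for u v w w'
    using that by (simp add: J_def br_add_left br_add_right D.M.a_ac)
  have reduce: "J u v w = \<zero>\<^bsub>D\<^esub>"
    if "w \<in> carrier D" "u \<in> carrier D" "v \<in> carrier D"
      "\<And>z. z \<in> carrier A \<Longrightarrow> J u v (d z) = \<zero>\<^bsub>D\<^esub>" for u v w
    using that by (induction w rule: differentials_induct) (simp_all add: smult add)
  have "J (d x) (d y) (d z) = \<zero>\<^bsub>D\<^esub>" if "x \<in> carrier A" "y \<in> carrier A" "z \<in> carrier A" for x y z
  proof -
    have "J (d x) (d y) (d z) = d \<zero>\<^bsub>A\<^esub>"
      using hom_jacobi[of x y z] that by (simp add: J_def br_d flip: d_add)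
    then show ?thesis using d_add[of "\<zero>\<^bsub>A\<^esub>" "\<zero>\<^bsub>A\<^esub>"] by simp
  qed
  \<comment> \<open>\<open>reduce\<close> frees only the last slot. A cyclic shift then brings
    another generator there, so three rounds free all slots.\<close>
  then have *: "J (d x) (d y) w = \<zero>\<^bsub>D\<^esub>" if "x \<in> carrier A" "y \<in> carrier A" "w \<in> carrier D" for x y w
    using that reduce by simp
  have **: "J (d y) w (d x) = \<zero>\<^bsub>D\<^esub>" if "x \<in> carrier A" "y \<in> carrier A" "w \<in> carrier D" for x y w
    using that *[of x y w] cycle[of "d x" "d y" w] by simp
  have ***: "J (d y) w v = \<zero>\<^bsub>D\<^esub>" if "y \<in> carrier A" "v \<in> carrier D" "w \<in> carrier D" for y v w
    using that reduce[of v "d y" w] ** by simp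
  have "J w v (d y) = \<zero>\<^bsub>D\<^esub>" if "y \<in> carrier A" "v \<in> carrier D" "w \<in> carrier D" for y v w
    using that ***[of y v w] cycle[of "d y" w v] by simp
  then have "J u v w = \<zero>\<^bsub>D\<^esub>"
    using assms reduce[of w u v] by simp
  then show ?thesis by (simp add: J_def)
qed

section \<open>Assembly of the hom-Lie-Rinehart structure\<close>

lemma differential_hom_lie_algebra: "hom_lie_algebra R (restrict_scalars A D) br \<alpha>"
proof -
  interpret RD: module R "restrict_scalars A D"
    by (rule module_restrict_scalars[OF algebra_axioms D.module_axioms])
  show ?thesis
  proof unfold_locales
    show "bilinear_map R (restrict_scalars A D) (restrict_scalars A D) (restrict_scalars A D) br"
      using bracket by (simp add: is_differential_bracket_def Let_def)
    show "linear_map R (restrict_scalars A D) (restrict_scalars A D) \<alpha>"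
      using alpha by (simp add: is_alpha_tilde_def Let_def)
  qed (simp_all add: differential_br_skew [symmetric] alpha_br differential_jacobi)
qed

lemma differential_hom_lie_representation:
  "hom_lie_representation R (restrict_scalars A D) br \<alpha> A (\<pi> \<circ> \<alpha>) \<phi>"
proof -
  interpret RD: hom_lie_algebra R "restrict_scalars A D" br \<alpha>
    by (rule differential_hom_lie_algebra)
  show ?thesis
  proof unfold_locales
    show "linear_map R (restrict_scalars A D) (End_module R A) (\<pi> \<circ> \<alpha>)"
      using pi_extensional
      by (auto simp: linear_map_def End_module_def pointwise_module_def extensional_def fun_eq_iff
          restrict_def pi_add_left pi_smult_left pi_add_right pi_smult_right smult_one_mult)
    show "linear_map R A A \<phi>"
      using endomorphism by (simp add: algebra_endomorphism_def)
    show "(\<pi> \<circ> \<alpha>) (br u v) (\<phi> c) =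
        (\<pi> \<circ> \<alpha>) (\<alpha> u) ((\<pi> \<circ> \<alpha>) v c) \<ominus>\<^bsub>A\<^esub> (\<pi> \<circ> \<alpha>) (\<alpha> v) ((\<pi> \<circ> \<alpha>) u c)"
      if "u \<in> carrier (restrict_scalars A D)" "v \<in> carrier (restrict_scalars A D)" "c \<in> carrier A" for u v c
      using that anchor_br [of u v c, symmetric] by (simp add: a_minus_def M.a_assoc M.r_neg)
  qed (simp_all add: anchor_twist)
qed

lemma differential_hom_lie_rinehart_algebra:
  "hom_lie_rinehart_algebra R A D br \<phi> \<alpha> (\<pi> \<circ> \<alpha>)"
proof (intro hom_lie_rinehart_algebra.intro hom_lie_rinehart_algebra_axioms.intro)
  have Der_smult: "smult (Der_module R A \<phi>) a f = (\<lambda>b\<in>carrier A. a \<otimes>\<^bsub>A\<^esub> f b)"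
    and Der_add: "add (Der_module R A \<phi>) f g = (\<lambda>b\<in>carrier A. f b \<oplus>\<^bsub>A\<^esub> g b)" for a f g
    by (simp_all add: Der_module_def pointwise_module_def regular_module_def)
  \<comment> \<open>Derivations are compared as functions on the whole type, so their values outside
    the carrier must be known too.\<close>
  have ext: "\<pi> u x = undefined" if "u \<in> carrier D" "x \<notin> carrier A" for u x
    using pi_extensional[OF that(1)] that(2) by (auto simp: extensional_def)
  show "linear_map R (restrict_scalars A D) (restrict_scalars A (Der_module R A \<phi>)) (\<pi> \<circ> \<alpha>)"
    by (auto simp: linear_map_def pi_Der Der_smult Der_add fun_eq_iff restrict_def ext
        pi_add_left pi_smult_left)
  show "(\<pi> \<circ> \<alpha>) (a \<odot>\<^bsub>D\<^esub> u) = \<phi> a \<odot>\<^bsub>Der_module R A \<phi>\<^esub> (\<pi> \<circ> \<alpha>) u"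
    if "a \<in> carrier A" "u \<in> carrier D" for a u
    using that by (auto simp: Der_smult fun_eq_iff restrict_def ext pi_smult_left)
qed (simp_all add: algebra_axioms D.module_axioms endomorphism differential_hom_lie_algebra differential_hom_lie_representation
    br_smult_right)

end

text \<open>The existence clause ensures that the universal clause is not vacuous. The latter covers
  every triple with the prescribed values, whatever its behaviour off the carriers.\<close>

theorem theorem6p5:
  fixes R :: "('r, 'p) ring_scheme"
    and A :: "('r, 'a, 'n) module_scheme"
    and P H :: "'a \<Rightarrow> 'a \<Rightarrow> 'a"
    and \<phi> :: "'a \<Rightarrow> 'a"
  assumes "poisson_algebra R A P"
    and "poisson_automorphism R A P \<phi>"
    and "H = (\<lambda>x y. \<phi> (P x y))"
  shows "purely_hom_poisson_algebra R A H \<phi> \<and>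
    (\<exists>\<alpha> \<pi> br. is_alpha_tilde R A \<phi> \<alpha> \<and> is_pi_star R A H \<phi> \<pi> \<and>
      is_differential_bracket R A H \<phi> \<alpha> (\<pi> \<circ> \<alpha>) br) \<and>
    (\<forall>\<alpha> \<pi> br. is_alpha_tilde R A \<phi> \<alpha> \<and> is_pi_star R A H \<phi> \<pi> \<and>
      is_differential_bracket R A H \<phi> \<alpha> (\<pi> \<circ> \<alpha>) br \<longrightarrow>
      hom_lie_rinehart_algebra R A (differentials R A \<phi>) br \<phi> \<alpha> (\<pi> \<circ> \<alpha>))"
proof -
  have hom_poisson: "purely_hom_poisson_algebra R A H \<phi>"
    using assms purely_hom_poisson_algebra_composition by blast
  interpret purely_hom_poisson_algebra R A H \<phi> by (rule hom_poisson)
  interpret hom_poisson_algebra_with_endomorphism R A H \<phi>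
    using assms(2) by unfold_locales (simp add: poisson_automorphism_def)
  have anchor: "differential_anchor R A H \<phi> \<alpha> \<pi>"
    if "is_alpha_tilde R A \<phi> \<alpha>" "is_pi_star R A H \<phi> \<pi>" for \<alpha> \<pi>
    using that by unfold_locales
  obtain \<alpha> \<pi> where "is_alpha_tilde R A \<phi> \<alpha>" "is_pi_star R A H \<phi> \<pi>"
    using ex_is_alpha_tilde ex_is_pi_star by blast
  moreover from this anchor obtain br where "is_differential_bracket R A H \<phi> \<alpha> (\<pi> \<circ> \<alpha>) br"
    using differential_anchor.ex_is_differential_bracket by blast
  moreover have "hom_lie_rinehart_algebra R A D br \<phi> \<alpha> (\<pi> \<circ> \<alpha>)"
    if "is_alpha_tilde R A \<phi> \<alpha>" "is_pi_star R A H \<phi> \<pi>"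
      "is_differential_bracket R A H \<phi> \<alpha> (\<pi> \<circ> \<alpha>) br" for \<alpha> \<pi> br
    by (rule differential_bracket.differential_hom_lie_rinehart_algebra,
        rule differential_bracket.intro[OF anchor[OF that(1,2)] differential_bracket_axioms.intro[OF that(3)]])
  ultimately show ?thesis using hom_poisson by blast
qed

end
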